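(* For every partition $\lambda$ with $\widetilde\lambda_1\le n$, the Schur element $\mathbf S_\lambda(n)$ is central in $\mathbf U(gl(n))$.
   Context: Virtual symbols. Let $\mathcal L=\{1,\dots,n\}$, and let $\mathcal A_0=\{\alpha_1,\dots,\alpha_{m_0}\}$, $\mathcal A_1=\{\beta_1,\dots,\beta_{m_1}\}$ be finite sets of auxiliary (virtual) symbols, with $m_0,m_1$ sufficiently large. Put $|a|=0\in\mathbb Z_2$ for $a\in\mathcal A_0$ and $|a|=1\in\mathbb Z_2$ for $a\in\mathcal A_1\cup\mathcal L$. Let $gl(m_0|m_1+n)$ be the complex Lie superalgebra with basis $e_{a,b}$, $a,b\in\mathcal A_0\cup\mathcal A_1\cup\mathcal L$, $|e_{a,b}|=|a|+|b|$, and superbracket $[e_{a,b},e_{c,d}]=\delta_{bc}e_{a,d}-(-1)^{(|a|+|b|)(|c|+|d|)}\delta_{ad}e_{c,b}$. Its enveloping superalgebra $\mathbf U(gl(m_0|m_1+n))$ contains $\mathbf U(gl(n))$ as the subalgebra generated by $e_{i,j}$, $i,j\in\mathcal L$. Devirtualization. A product $e_{a_m,b_m}\cdots e_{a_1,b_1}$ is irregular if there are $i\le m$ and a virtual symbol $\gamma\in\mathcal A_0\cup\mathcal A_1$ with $\#\{j\le i: b_j=\gamma\}>\#\{j<i: a_j=\gamma\}$. Let $\mathbf{Irr}$ be the left ideal of $\mathbf U(gl(m_0|m_1+n))$ generated by the irregular products. The sum $Virt=\mathbf U(gl(n))+\mathbf{Irr}$ is direct and is a subalgebra, in which $\mathbf{Irr}$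 is a two-sided ideal; $\mathfrak p:Virt\to\mathbf U(gl(n))$ denotes the projection with kernel $\mathbf{Irr}$ (an algebra epimorphism). Tableaux. A Young tableau of shape $\lambda$ over an alphabet is any filling of the cells of the Ferrers diagram of $\lambda$ (rows of lengths $\lambda_1\ge\lambda_2\ge\cdots$). For tableaux $S,T$ of the same shape, $e_{S,T}$ is the product of the $e_{S(c),T(c)}$ over the cells $c$, read row by row from top to bottom, left to right in each row. $D^*_\lambda$ is the tableau of shape $\lambda$ whose $r$-th row is $\beta_1\beta_2\cdots\beta_{\lambda_r}$, and $C^*_\lambda$ the tableau of shape $\lambda$ whose $r$-th row is $\alpha_r\alpha_r\cdots\alpha_r$ (the $\alpha$'s and $\beta$'s being arbitrary distinct positive, resp. negative, virtual symbols). For tableaux $S,T$ of shape $\lambda$ over $\mathcal L$, the double Young-Capelli bitableau is $[\,\boxed{S\,|\,T}\,]=\mathfrak p\big(e_{S,C^*_\lambda}e_{C^*_\lambda,D^*_\lambda}e_{D^*_\lambda,C^*_\lambda}e_{C^*_\lambda,T}\big)\in\mathbf U(gl(n))$; the argument of $\mathfrak p$ lies in $Virt$ and the result does not depend on the choice of virtual symbols. Schur elements. $\widetilde\lambda$ is the conjugate partition and $H(\lambda)=H(\widetilde\lambda)$ the product of the hook lengths of all boxes of the Ferrers diagram. For $\widetilde\lambda_1\le n$, $\mathbf S_\lambda(n)=\frac1{H(\widetilde\lambda)}\sum_S[\,\boxed{S\,|\,S}\,]\in\mathbf U(gl(n))$, the sum over all tableaux $S$ of shape $\widetilde\lambda$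 on $\mathcal L$ with strictly increasing rows (no condition on columns); $\mathbf S_\emptyset(n)=\mathbf 1$. *)

theory Defs
  imports Complex_Main "HOL-Library.Poly_Mapping" "HOL-Library.More_List" "HOL-Library.Cardinality"
begin

section \<open>Free associative algebras over the complex numbers\<close>

text \<open>
  Words under concatenation, written additively so that the convolution product of
  \<^theory>\<open>HOL-Library.Poly_Mapping\<close> makes \<open>'g fword \<Rightarrow>\<^sub>0 complex\<close> the free associative unital
  algebra on \<open>'g\<close>.
\<close>

datatype 'g fword = FWord (letters: "'g list")

instantiation fword :: (type) monoid_add
begin

definition zero_fword :: "'a fword" where
  "0 = FWord []"

definition plus_fword :: "'a fword \<Rightarrow> 'a fword \<Rightarrow> 'a fword" where
  "u + v = FWord (letters u @ letters v)"

instance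
  by standard (simp_all add: zero_fword_def plus_fword_def)

end

type_synonym 'g free_alg = "'g fword \<Rightarrow>\<^sub>0 complex"

definition free_gen :: "'g \<Rightarrow> 'g free_alg" where
  "free_gen g = Poly_Mapping.single (FWord [g]) 1"

definition free_const :: "complex \<Rightarrow> 'g free_alg" where
  "free_const c = Poly_Mapping.single 0 c"

lemma fword_add_eq_0_iff: "u + v = 0 \<longleftrightarrow> u = 0 \<and> v = (0 :: 'g fword)"
  by (cases u; cases v) (simp add: zero_fword_def plus_fword_def)

lemma lookup_mult_0:
  fixes p q :: "'g free_alg"
  shows "Poly_Mapping.lookup (p * q) 0 = Poly_Mapping.lookup p 0 * Poly_Mapping.lookup q 0"
proof -
  let ?p = "Poly_Mapping.lookup p" and ?q = "Poly_Mapping.lookup q"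
  have "Poly_Mapping.lookup (p * q) 0
      = Sum_any (\<lambda>u. ?p u * Sum_any (\<lambda>v. ?q v when 0 = u + v))"
    by (simp add: times_poly_mapping.rep_eq prod_fun_def)
  also have "\<dots> = Sum_any (\<lambda>u. ?p u * ?q 0 when u = 0)"
  proof (rule Sum_any.cong)
    fix u :: "'g fword"
    show "?p u * Sum_any (\<lambda>v. ?q v when 0 = u + v) = (?p u * ?q 0 when u = 0)"
    proof (cases "u = 0")
      case True
      then show ?thesis by simp
    next
      case False
      then have "0 \<noteq> u + v" for v
        using fword_add_eq_0_iff[of u v] by metis
      with False show ?thesis by simp
    qed
  qed
  finally show ?thesis by simp
qed


section \<open>The enveloping superalgebra of \<open>gl(m\<^sub>0|m\<^sub>1+n)\<close>\<close>

text \<open>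
  \<open>'a\<close> and \<open>'b\<close> index the positive and negative virtual symbols, \<open>'l\<close> the proper symbols;
  \<open>m\<^sub>0 = CARD('a)\<close>, \<open>m\<^sub>1 = CARD('b)\<close> and \<open>n = CARD('l)\<close>. The linear order on \<open>'l\<close>, needed only for
  row-strict tableaux, makes it a copy of \<open>{1, \<dots>, n}\<close>.
\<close>

datatype ('a, 'b, 'l) symbol = Alpha 'a | Beta 'b | Proper 'l

fun is_virtual :: "('a, 'b, 'l) symbol \<Rightarrow> bool" where
  "is_virtual (Alpha _) = True"
| "is_virtual (Beta _) = True"
| "is_virtual (Proper _) = False"

text \<open>Representatives in \<open>{0, 1}\<close> of the \<open>\<int>\<^sub>2\<close>-degrees; they only occur in exponents of \<open>-1\<close>.\<close>

fun deg :: "('a, 'b, 'l) symbol \<Rightarrow> nat" where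
  "deg (Alpha _) = 0"
| "deg (Beta _) = 1"
| "deg (Proper _) = 1"

type_synonym ('a, 'b, 'l) gl_index = "('a, 'b, 'l) symbol \<times> ('a, 'b, 'l) symbol"

definition super_sign :: "('a, 'b, 'l) gl_index \<Rightarrow> ('a, 'b, 'l) gl_index \<Rightarrow> complex" where
  "super_sign x y = (-1) ^ ((deg (fst x) + deg (snd x)) * (deg (fst y) + deg (snd y)))"

text \<open>The superbracket of two basis vectors of \<open>gl\<close>, as a linear element of the free algebra.\<close>

definition gl_bracket :: "('a, 'b, 'l) gl_index \<Rightarrow> ('a, 'b, 'l) gl_index
    \<Rightarrow> ('a, 'b, 'l) gl_index free_alg" where
  "gl_bracket x y =
     (if snd x = fst y then free_gen (fst x, snd y) else 0)
     - free_const (super_sign x y) * (if fst x = snd y then free_gen (fst y, snd x) else 0)"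

definition env_relator :: "('a, 'b, 'l) gl_index \<Rightarrow> ('a, 'b, 'l) gl_index
    \<Rightarrow> ('a, 'b, 'l) gl_index free_alg" where
  "env_relator x y =
     free_gen x * free_gen y - free_const (super_sign x y) * (free_gen y * free_gen x)
     - gl_bracket x y"

inductive_set env_ideal :: "('a, 'b, 'l) gl_index free_alg set" where
  zero: "0 \<in> env_ideal"
| relator: "p * env_relator x y * q \<in> env_ideal"
| add: "r \<in> env_ideal \<Longrightarrow> s \<in> env_ideal \<Longrightarrow> r + s \<in> env_ideal"

lemma env_ideal_mult_left: "r \<in> env_ideal \<Longrightarrow> p * r \<in> env_ideal"
proof (induction rule: env_ideal.induct)
  case zero
  then show ?case by (simp add: env_ideal.zero)
next
  case (relator p' x y q)
  then show ?case
    using env_ideal.relator[of "p * p'" x y q] by (simp add: mult.assoc)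
next
  case (add r s)
  then show ?case by (simp add: distrib_left env_ideal.add)
qed

lemma env_ideal_mult_right: "r \<in> env_ideal \<Longrightarrow> r * q \<in> env_ideal"
proof (induction rule: env_ideal.induct)
  case zero
  then show ?case by (simp add: env_ideal.zero)
next
  case (relator p x y q')
  then show ?case
    using env_ideal.relator[of p x y "q' * q"] by (simp add: mult.assoc)
next
  case (add r s)
  then show ?case by (simp add: distrib_right env_ideal.add)
qed

lemma env_ideal_uminus: "r \<in> env_ideal \<Longrightarrow> - r \<in> env_ideal"
  using env_ideal_mult_left[of r "-1"] by simp

lemma env_ideal_diff: "r \<in> env_ideal \<Longrightarrow> s \<in> env_ideal \<Longrightarrow> r - s \<in> env_ideal"
  using env_ideal.add[OF _ env_ideal_uminus] by fastforce

lemma lookup_free_gen_0 [simp]: "Poly_Mapping.lookup (free_gen g) 0 = 0"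
  by (simp add: free_gen_def lookup_single zero_fword_def)

lemma lookup_env_relator_0: "Poly_Mapping.lookup (env_relator x y) 0 = 0"
  by (simp add: env_relator_def gl_bracket_def lookup_minus lookup_mult_0)

lemma lookup_env_ideal_0: "r \<in> env_ideal \<Longrightarrow> Poly_Mapping.lookup r 0 = 0"
  by (induction rule: env_ideal.induct)
     (simp_all add: lookup_add lookup_mult_0 lookup_env_relator_0)

definition env_cong :: "('a, 'b, 'l) gl_index free_alg \<Rightarrow> ('a, 'b, 'l) gl_index free_alg \<Rightarrow> bool" where
  "env_cong p q \<longleftrightarrow> p - q \<in> env_ideal"

lemma env_cong_equivp: "equivp env_cong"
proof (rule equivpI)
  show "reflp env_cong"
    by (simp add: reflp_def env_cong_def env_ideal.zero)
  show "symp env_cong"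
    using env_ideal_uminus by (fastforce simp: symp_def env_cong_def)
  show "transp env_cong"
    using env_ideal.add by (fastforce simp: transp_def env_cong_def)
qed

quotient_type ('a, 'b, 'l) super_env = "('a, 'b, 'l) gl_index free_alg" / env_cong
  by (rule env_cong_equivp)

instantiation super_env :: (type, type, type) ring_1
begin

lift_definition zero_super_env :: "('a, 'b, 'c) super_env" is 0 .

lift_definition one_super_env :: "('a, 'b, 'c) super_env" is 1 .

lift_definition plus_super_env ::
    "('a, 'b, 'c) super_env \<Rightarrow> ('a, 'b, 'c) super_env \<Rightarrow> ('a, 'b, 'c) super_env"
  is "(+)"
  unfolding env_cong_def by (subst add_diff_add) (rule env_ideal.add)

lift_definition uminus_super_env :: "('a, 'b, 'c) super_env \<Rightarrow> ('a, 'b, 'c) super_env"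
  is uminus
  unfolding env_cong_def by (subst minus_diff_minus) (rule env_ideal_uminus)

lift_definition minus_super_env ::
    "('a, 'b, 'c) super_env \<Rightarrow> ('a, 'b, 'c) super_env \<Rightarrow> ('a, 'b, 'c) super_env"
  is "(-)"
proof -
  fix p p' q q' :: "('a, 'b, 'c) gl_index free_alg"
  assume "env_cong p p'" "env_cong q q'"
  then have "(p - p') - (q - q') \<in> env_ideal"
    unfolding env_cong_def by (rule env_ideal_diff)
  then show "env_cong (p - q) (p' - q')"
    by (simp add: env_cong_def algebra_simps)
qed

lift_definition times_super_env ::
    "('a, 'b, 'c) super_env \<Rightarrow> ('a, 'b, 'c) super_env \<Rightarrow> ('a, 'b, 'c) super_env"
  is "(*)"
proof -
  fix p p' q q' :: "('a, 'b, 'c) gl_index free_alg"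
  assume "env_cong p p'" "env_cong q q'"
  then have "(p - p') * q + p' * (q - q') \<in> env_ideal"
    unfolding env_cong_def
    by (intro env_ideal.add env_ideal_mult_left env_ideal_mult_right)
  then show "env_cong (p * q) (p' * q')"
    by (simp add: env_cong_def algebra_simps)
qed

instance
proof
  fix x y z :: "('a, 'b, 'c) super_env"
  have refl: "env_cong p p" for p :: "('a, 'b, 'c) gl_index free_alg"
    by (simp add: env_cong_def env_ideal.zero)
  show "x + y + z = x + (y + z)"
    by transfer (simp add: refl add.assoc)
  show "x + y = y + x"
    by transfer (simp add: refl add.commute)
  show "0 + x = x"
    by transfer (simp add: refl)
  show "- x + x = 0"
    by transfer (simp add: refl)
  show "x - y = x + - y"
    by transfer (simp add: refl)
  show "x * y * z = x * (y * z)"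
    by transfer (simp add: refl mult.assoc)
  show "1 * x = x" "x * 1 = x"
    by (transfer, simp add: refl)+
  show "(x + y) * z = x * z + y * z"
    by transfer (simp add: refl distrib_right)
  show "x * (y + z) = x * y + x * z"
    by transfer (simp add: refl distrib_left)
  show "(0 :: ('a, 'b, 'c) super_env) \<noteq> 1"
  proof transfer
    show "\<not> env_cong (0 :: ('a, 'b, 'c) gl_index free_alg) 1"
      using lookup_env_ideal_0[of "0 - 1 :: ('a, 'b, 'c) gl_index free_alg"]
      by (auto simp: env_cong_def lookup_one)
  qed
qed

end

lift_definition scale_env :: "complex \<Rightarrow> ('a, 'b, 'l) super_env \<Rightarrow> ('a, 'b, 'l) super_env"
    (infixr \<open>*\<^sub>U\<close> 75)
  is "\<lambda>c p. free_const c * p"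
  unfolding env_cong_def by (subst right_diff_distrib [symmetric]) (rule env_ideal_mult_left)

lift_definition env_gen :: "('a, 'b, 'l) gl_index \<Rightarrow> ('a, 'b, 'l) super_env"
  is free_gen .

lemma env_gen_supercommutator:
  "env_gen (a, b) * env_gen (c, d) - super_sign (a, b) (c, d) *\<^sub>U (env_gen (c, d) * env_gen (a, b)) =
     (if b = c then env_gen (a, d) else 0)
     - super_sign (a, b) (c, d) *\<^sub>U (if a = d then env_gen (c, b) else 0)"
proof transfer
  fix a b c d :: "('a, 'b, 'l) symbol"
  show "env_cong
      (free_gen (a, b) * free_gen (c, d)
        - free_const (super_sign (a, b) (c, d)) * (free_gen (c, d) * free_gen (a, b)))
      ((if b = c then free_gen (a, d) else 0)
        - free_const (super_sign (a, b) (c, d)) * (if a = d then free_gen (c, b) else 0))"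
    using env_ideal.relator[of 1 "(a, b)" "(c, d)" 1]
    unfolding env_cong_def env_relator_def gl_bracket_def fst_conv snd_conv mult_1_left mult_1_right .
qed

definition env_word :: "('a, 'b, 'l) gl_index list \<Rightarrow> ('a, 'b, 'l) super_env" where
  "env_word w = prod_list (map env_gen w)"


section \<open>Devirtualization\<close>

text \<open>The subalgebra \<open>U(gl(n))\<close>.\<close>

inductive_set env_proper :: "('a, 'b, 'l) super_env set" where
  one: "1 \<in> env_proper"
| gen: "env_gen (Proper i, Proper j) \<in> env_proper"
| add: "x \<in> env_proper \<Longrightarrow> y \<in> env_proper \<Longrightarrow> x + y \<in> env_proper"
| mult: "x \<in> env_proper \<Longrightarrow> y \<in> env_proper \<Longrightarrow> x * y \<in> env_proper"
| scale: "x \<in> env_proper \<Longrightarrow> c *\<^sub>U x \<in> env_proper"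

text \<open>
  A product \<open>e\<^bsub>a\<^sub>m,b\<^sub>m\<^esub> \<dots> e\<^bsub>a\<^sub>1,b\<^sub>1\<^esub>\<close> is the list \<open>[(a\<^sub>m, b\<^sub>m), \<dots>, (a\<^sub>1, b\<^sub>1)]\<close>, so that \<open>p # v\<close> below
  holds the factors with index \<open>j \<le> i\<close>, and \<open>v\<close> those with \<open>j < i\<close>.
\<close>

definition irregular :: "('a, 'b, 'l) gl_index list \<Rightarrow> bool" where
  "irregular w \<longleftrightarrow>
     (\<exists>u p v \<gamma>. w = u @ p # v \<and> is_virtual \<gamma> \<and>
        count_list (map snd (p # v)) \<gamma> > count_list (map fst v) \<gamma>)"

inductive_set Irr :: "('a, 'b, 'l) super_env set" where
  zero: "0 \<in> Irr"
| gen: "irregular w \<Longrightarrow> x * env_word w \<in> Irr"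
| add: "x \<in> Irr \<Longrightarrow> y \<in> Irr \<Longrightarrow> x + y \<in> Irr"

text \<open>
  The projection of \<open>Virt = U(gl(n)) \<oplus> Irr\<close> onto \<open>U(gl(n))\<close> with kernel \<open>Irr\<close>: uniqueness of \<open>u\<close> is
  the directness of the sum. Values outside \<open>Virt\<close> are immaterial.
\<close>

definition devirt :: "('a, 'b, 'l) super_env \<Rightarrow> ('a, 'b, 'l) super_env" where
  "devirt x = (THE u. u \<in> env_proper \<and> (\<exists>v \<in> Irr. x = u + v))"


section \<open>Partitions\<close>

text \<open>Partitions are lists of parts; rows and columns of diagrams are numbered from 0.\<close>

definition is_partition :: "nat list \<Rightarrow> bool" where
  "is_partition lam \<longleftrightarrow> sorted_wrt (\<ge>) lam \<and> 0 \<notin> set lam"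

definition ferrers :: "nat list \<Rightarrow> (nat \<times> nat) set" where
  "ferrers lam = {(i, j). i < length lam \<and> j < lam ! i}"

definition conjugate :: "nat list \<Rightarrow> nat list" where
  "conjugate lam = map (\<lambda>j. card {i. (i, j) \<in> ferrers lam}) [0..<nth_default 0 lam 0]"

definition hook :: "nat list \<Rightarrow> nat \<times> nat \<Rightarrow> (nat \<times> nat) set" where
  "hook lam c = {(i, j) \<in> ferrers lam. i = fst c \<and> j \<ge> snd c \<or> j = snd c \<and> i \<ge> fst c}"

definition hook_product :: "nat list \<Rightarrow> nat" where
  "hook_product lam = (\<Prod>c \<in> ferrers lam. card (hook lam c))"


section \<open>Double Young--Capelli bitableaux and Schur elements\<close>

text \<open>A tableau is the list of its rows; its shape is the list of the row lengths.\<close>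

definition env_bitableau ::
    "('a, 'b, 'l) symbol list list \<Rightarrow> ('a, 'b, 'l) symbol list list \<Rightarrow> ('a, 'b, 'l) super_env" where
  "env_bitableau S T = env_word (zip (concat S) (concat T))"

text \<open>
  The virtual symbols are supplied by \<open>\<alpha>\<close> and \<open>\<beta>\<close>, indexed from 1, which are meant to be
  injective on \<open>{1..length \<mu>}\<close> and on \<open>{1..\<mu>\<^sub>1}\<close> respectively.
\<close>

definition coDeruyts :: "(nat \<Rightarrow> 'a) \<Rightarrow> nat list \<Rightarrow> ('a, 'b, 'l) symbol list list" where
  "coDeruyts \<alpha> \<mu> = map (\<lambda>r. replicate (\<mu> ! (r - 1)) (Alpha (\<alpha> r))) [1..<Suc (length \<mu>)]"

definition Deruyts :: "(nat \<Rightarrow> 'b) \<Rightarrow> nat list \<Rightarrow> ('a, 'b, 'l) symbol list list" where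
  "Deruyts \<beta> \<mu> = map (\<lambda>k. map (\<lambda>j. Beta (\<beta> j)) [1..<Suc k]) \<mu>"

definition double_young_capelli ::
    "(nat \<Rightarrow> 'a) \<Rightarrow> (nat \<Rightarrow> 'b) \<Rightarrow> nat list \<Rightarrow> 'l list list \<Rightarrow> 'l list list
      \<Rightarrow> ('a, 'b, 'l) super_env" where
  "double_young_capelli \<alpha> \<beta> \<mu> S T =
     (let C = coDeruyts \<alpha> \<mu>; D = Deruyts \<beta> \<mu> in
        devirt (env_bitableau (map (map Proper) S) C * env_bitableau C D
              * env_bitableau D C * env_bitableau C (map (map Proper) T)))"

definition row_strict_tableaux :: "nat list \<Rightarrow> 'l::linorder list list set" where
  "row_strict_tableaux \<mu> = {S. map length S = \<mu> \<and> (\<forall>row \<in> set S. sorted_wrt (<) row)}"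

definition schur_element ::
    "(nat \<Rightarrow> 'a) \<Rightarrow> (nat \<Rightarrow> 'b) \<Rightarrow> nat list
      \<Rightarrow> ('a, 'b, 'l::{finite,linorder}) super_env" where
  "schur_element \<alpha> \<beta> lam =
     (1 / of_nat (hook_product (conjugate lam))) *\<^sub>U
       (\<Sum>S \<in> row_strict_tableaux (conjugate lam).
          double_young_capelli \<alpha> \<beta> (conjugate lam) S S)"

definition center_of :: "'r::ring_1 set \<Rightarrow> 'r set" where
  "center_of A = {z \<in> A. \<forall>x \<in> A. z * x = x * z}"

end

theory Submission
  imports Defs "HOL-Combinatorics.Multiset_Permutations"
begin

text \<open>
  The left ideal \<open>Irr\<close> coincides with the left ideal generated by the \<open>e\<^bsub>a,g\<^esub>\<close> with \<open>g\<close> virtual. It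
  meets \<open>U(gl(n))\<close> only in \<open>0\<close>: the superderivations \<open>x\<^bsub>c,k\<^esub> \<mapsto> \<delta>\<^bsub>b,c\<^esub> x\<^bsub>a,k\<^esub>\<close> of a free algebra define
  a representation in which \<open>Irr\<close> kills every monomial in proper letters, while a filtered leading-term
  argument at \<open>x = 1\<close> shows that \<open>U(gl(n))\<close> acts faithfully on these. A weight argument shows that every
  word with balanced virtual content lies in \<open>U(gl(n)) + Irr\<close>, so that the devirtualization of the words
  under consideration is well defined. Finally, since the generators \<open>e\<^bsub>s,\<alpha>\<^esub>\<close> for \<open>s\<close> proper anticommute,
  the sum over row-strict tableaux is, up to a factorial factor, the sum over all tableaux. The latter is
  an invariant contraction, hence commutes with every \<open>e\<^bsub>i,j\<^esub>\<close>, and centrality descends through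
  the projection because \<open>Irr\<close> is stable under multiplication by \<open>U(gl(n))\<close> on both sides.
\<close>

section \<open>Scalars and commutation in the enveloping superalgebra\<close>

lemma poly_mapping_add_single_induct [case_names zero add_single]:
  fixes p :: "'k \<Rightarrow>\<^sub>0 'c::comm_monoid_add"
  assumes zero: "P 0"
    and add_single: "\<And>p k c. P p \<Longrightarrow> P (p + Poly_Mapping.single k c)"
  shows "P p"
proof (induction p rule: update_induct)
  case (update p k c)
  have "Poly_Mapping.update k c p = p + Poly_Mapping.single k c"
    using update(1) by (intro poly_mapping_eqI)
      (auto simp: lookup_update lookup_add lookup_single when_def in_keys_iff)
  then show ?case using add_single update(3) by simp
qed (rule zero)

lemma free_const_commute: "free_const c * p = p * free_const c"
proof (induction p rule: poly_mapping_add_single_induct)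
  case (add_single p k d)
  then show ?case
    by (simp add: distrib_left distrib_right free_const_def mult_single mult.commute)
qed simp

lemma free_const_mult: "free_const c * free_const d = free_const (c * d)"
  by (simp add: free_const_def mult_single)

lemma free_const_1 [simp]: "free_const 1 = 1"
  by (simp add: free_const_def)

lemma free_const_add: "free_const (c + d) = free_const c + free_const d"
  by (simp add: free_const_def single_add)

lemma env_cong_refl: "env_cong p p"
  by (simp add: env_cong_def env_ideal.zero)

lemma scale_env_mult_left: "c *\<^sub>U (x * y) = (c *\<^sub>U x) * y"
  by transfer (simp add: mult.assoc env_cong_refl)

lemma scale_env_mult_right: "c *\<^sub>U (x * y) = x * (c *\<^sub>U y)"
proof transfer
  fix c and x y :: "('a, 'b, 'c) gl_index free_alg"
  have "free_const c * (x * y) = x * (free_const c * y)"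
    by (metis free_const_commute mult.assoc)
  then show "env_cong (free_const c * (x * y)) (x * (free_const c * y))"
    by (simp add: env_cong_refl)
qed

lemma scale_env_add: "c *\<^sub>U (x + y) = c *\<^sub>U x + c *\<^sub>U y"
  by transfer (simp add: distrib_left env_cong_refl)

lemma scale_env_add_left: "(c + d) *\<^sub>U x = c *\<^sub>U x + d *\<^sub>U x"
  by transfer (simp add: distrib_right free_const_add env_cong_refl)

lemma scale_env_scale: "c *\<^sub>U d *\<^sub>U x = (c * d) *\<^sub>U x"
  by transfer (simp add: mult.assoc [symmetric] free_const_mult env_cong_refl)

lemma scale_env_1 [simp]: "1 *\<^sub>U x = x"
  by transfer (simp add: env_cong_refl)

lemma scale_env_zero_right [simp]: "c *\<^sub>U 0 = 0"
  using scale_env_add [of c 0 0] by simp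

lemma scale_env_zero_left [simp]: "0 *\<^sub>U x = 0"
  using scale_env_add_left [of 0 0 x] by simp

lemma scale_env_minus_left: "(- c) *\<^sub>U x = - (c *\<^sub>U x)"
  using scale_env_add_left [of "- c" c x] by (simp add: eq_neg_iff_add_eq_0)

lemma scale_env_minus_right: "c *\<^sub>U (- x) = - (c *\<^sub>U x)"
  using scale_env_add [of c "- x" x] by (simp add: eq_neg_iff_add_eq_0)

lemma scale_env_diff: "c *\<^sub>U (x - y) = c *\<^sub>U x - c *\<^sub>U y"
  using scale_env_add [of c x "- y"] by (simp add: scale_env_minus_right)

lemma scale_env_of_nat: "of_nat n *\<^sub>U x = of_nat n * x"
  by (induction n) (simp_all add: scale_env_add_left distrib_right)

text \<open>Two is invertible among the complex scalars; this later turns anticommutation of an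
  element with itself into a vanishing square.\<close>

lemma env_double_eq_0: "x + x = 0 \<Longrightarrow> x = (0 :: ('a, 'b, 'c) super_env)"
proof -
  assume "x + x = 0"
  then have "(1/2) *\<^sub>U (x + x) = 0" by simp
  then show "x = 0" by (simp add: scale_env_add scale_env_add_left [symmetric])
qed

lemma super_sign_cases: "super_sign x y = 1 \<or> super_sign x y = -1"
  unfolding super_sign_def by (metis minus_one_power_iff)

lemma env_word_Nil [simp]: "env_word [] = 1"
  and env_word_Cons [simp]: "env_word (x # w) = env_gen x * env_word w"
  and env_word_append: "env_word (v @ w) = env_word v * env_word w"
  by (simp_all add: env_word_def)

lemma env_gen_swap:
  "env_gen (a, b) * env_gen (c, d) =
     super_sign (a, b) (c, d) *\<^sub>U (env_gen (c, d) * env_gen (a, b))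
     + (if b = c then env_gen (a, d) else 0)
     - super_sign (a, b) (c, d) *\<^sub>U (if a = d then env_gen (c, b) else 0)"
  using env_gen_supercommutator [of a b c d] by (simp add: algebra_simps)


section \<open>A right action on functions of words\<close>

text \<open>
  A word \<open>(c\<^sub>1, k\<^sub>1) \<dots> (c\<^sub>r, k\<^sub>r)\<close> stands for the noncommutative monomial in the entries
  \<open>z\<^bsub>c,k\<^esub> = x\<^bsub>c,k\<^esub> - \<delta>\<^bsub>c,k\<^esub>\<close> of a generic matrix, \<open>z\<^bsub>c,k\<^esub>\<close> having degree \<open>|c| + 1\<close>.
  The generator \<open>e\<^bsub>a,b\<^esub>\<close> acts on monomials as the superderivation \<open>x\<^bsub>c,k\<^esub> \<mapsto> \<delta>\<^bsub>b,c\<^esub> x\<^bsub>a,k\<^esub>\<close>,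
  which in the coordinates \<open>z\<close> acquires a constant term; \<open>word_act\<close> is the transposed action on
  functionals.
\<close>

definition letter_sign :: "('a, 'b, 'l) gl_index \<Rightarrow> ('a, 'b, 'l) symbol \<Rightarrow> complex" where
  "letter_sign x c = (-1) ^ ((deg (fst x) + deg (snd x)) * (deg c + 1))"

fun word_act :: "('a, 'b, 'l) gl_index \<Rightarrow> ((('a, 'b, 'l) symbol \<times> 'l) list \<Rightarrow> complex)
    \<Rightarrow> (('a, 'b, 'l) symbol \<times> 'l) list \<Rightarrow> complex" where
  "word_act x F [] = 0"
| "word_act x F ((c, k) # w) =
     (if snd x = c then F ((fst x, k) # w) + (if fst x = Proper k then F w else 0) else 0)
     + letter_sign x c * word_act x (\<lambda>w. F ((c, k) # w)) w"

lemma word_act_add: "word_act x (\<lambda>w. F w + G w) w = word_act x F w + word_act x G w"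
proof (induction w arbitrary: F G)
  case (Cons l w)
  obtain c k where l: "l = (c, k)" by (cases l)
  show ?case using Cons [of "\<lambda>w. F (l # w)" "\<lambda>w. G (l # w)"] by (simp add: l algebra_simps)
qed simp

lemma word_act_scale: "word_act x (\<lambda>w. t * F w) w = t * word_act x F w"
proof (induction w arbitrary: F)
  case (Cons l w)
  obtain c k where l: "l = (c, k)" by (cases l)
  show ?case using Cons [of "\<lambda>w. F (l # w)"] by (simp add: l algebra_simps)
qed simp

lemma word_act_zero [simp]: "word_act x (\<lambda>w. 0) w = 0"
  using word_act_scale [of x 0 "\<lambda>w. 0" w] by simp

lemma word_act_fun_add: "word_act x (\<lambda>w. F w + G w) = (\<lambda>w. word_act x F w + word_act x G w)"
  and word_act_fun_scale: "word_act x (\<lambda>w. t * F w) = (\<lambda>w. t * word_act x F w)"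
  by (simp_all add: fun_eq_iff word_act_add word_act_scale)

lemma word_act_Cons_fun:
  "word_act y (\<lambda>v. word_act x F ((c, k) # v)) w =
    (if snd x = c then word_act y (\<lambda>v. F ((fst x, k) # v)) w
       + (if fst x = Proper k then word_act y F w else 0) else 0)
     + letter_sign x c * word_act y (word_act x (\<lambda>w. F ((c, k) # w))) w"
  by (simp add: word_act_add word_act_scale)

lemma super_sign_commute: "super_sign x y = super_sign y x"
  by (simp add: super_sign_def mult.commute)

lemma super_sign_square [simp]: "super_sign x y * (super_sign x y * z) = z"
  using super_sign_cases [of x y] by auto

text \<open>Replacing the row index \<open>snd y\<close> of a letter by \<open>fst y\<close> changes
  its parity by that of \<open>y\<close>, which costs \<open>super_sign x y\<close>.\<close>

lemma letter_sign_fst: "letter_sign x (fst y) = super_sign x y * letter_sign x (snd y)"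
  by (cases "fst x"; cases "snd x"; cases "fst y"; cases "snd y")
     (simp_all add: letter_sign_def super_sign_def)

lemma letter_sign_Proper [simp]: "letter_sign x (Proper k) = 1"
  by (simp add: letter_sign_def power_add [symmetric] power_mult mult.commute)

lemma letter_sign_bracket:
  assumes "snd x = fst y"
  shows "letter_sign (fst x, snd y) c = letter_sign x c * letter_sign y c"
  using assms by (cases "fst x"; cases "snd x"; cases "snd y"; cases c)
     (simp_all add: letter_sign_def)

text \<open>Transposition reverses composition, so the product of \<open>x\<close> and
  \<open>y\<close> acts as \<open>word_act y (word_act x F)\<close>. When both hit the first letter
  the bracket appears; when they hit different letters the terms cancel; the rest is the induction
  hypothesis.\<close>

lemma word_act_bracket:
  "word_act y (word_act x F) w - super_sign x y * word_act x (word_act y F) w =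
    (if snd x = fst y then word_act (fst x, snd y) F w else 0)
    - super_sign x y * (if fst x = snd y then word_act (fst y, snd x) F w else 0)"
proof (induction w arbitrary: F)
  case (Cons l w)
  obtain c k where l: "l = (c, k)" by (cases l)
  let ?F = "\<lambda>w. F ((c, k) # w)"
  let ?s = "super_sign x y"
  let ?t = "letter_sign x c * letter_sign y c"
  note IH = Cons [of ?F]
  \<comment> \<open>The induction hypothesis, multiplied by the signs that both operators pick up on
    passing the first letter.\<close>
  have IH': "?t * word_act y (word_act x ?F) w = ?s * ?t * word_act x (word_act y ?F) w
     + ?t * (if snd x = fst y then word_act (fst x, snd y) ?F w else 0)
     - ?s * ?t * (if fst x = snd y then word_act (fst y, snd x) ?F w else 0)"
    using arg_cong [OF IH, of "\<lambda>z. ?t * z"] by (simp add: algebra_simps)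
  have sx: "letter_sign x (fst y) = ?s * letter_sign x (snd y)"
    by (rule letter_sign_fst)
  have sy: "letter_sign y (fst x) = ?s * letter_sign y (snd x)"
    by (subst super_sign_commute) (rule letter_sign_fst)
  \<comment> \<open>If \<open>y\<close> turns the first letter into one with row index
    \<open>Proper k\<close>, the new letter is even and \<open>x\<close> passes it without sign.
    This makes the constant terms compatible with the signs.\<close>
  have px: "fst y = Proper k \<Longrightarrow> ?s * letter_sign x (snd y) = 1"
    using sx by simp
  have py: "fst x = Proper k \<Longrightarrow> ?s * letter_sign y (snd x) = 1"
    using sy by simp
  have bx: "snd x = fst y \<Longrightarrow> letter_sign (fst x, snd y) c = ?t"
    by (rule letter_sign_bracket)
  have by': "fst x = snd y \<Longrightarrow> letter_sign (fst y, snd x) c = ?t"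
    using letter_sign_bracket [of y x c] by simp
  define A B P Q X Y G H where
    "A = word_act y (word_act x ?F) w" and "B = word_act x (word_act y ?F) w" and
    "P = word_act x (\<lambda>v. F ((fst y, k) # v)) w" and "Q = word_act y (\<lambda>v. F ((fst x, k) # v)) w" and
    "X = (if fst y = Proper k then word_act x F w else 0)" and
    "Y = (if fst x = Proper k then word_act y F w else 0)" and
    "G = F ((fst x, k) # w) + (if fst x = Proper k then F w else 0)" and
    "H = F ((fst y, k) # w) + (if fst y = Proper k then F w else 0)"
  define p q where "p = letter_sign x c" and "q = letter_sign y c"
  define C where "C = (if snd x = fst y then word_act (fst x, snd y) ?F w else 0)"
  define D where "D = (if fst x = snd y then word_act (fst y, snd x) ?F w else 0)"
  have X: "p * X = ?s * X" if "snd y = c"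
  proof -
    have "fst y = Proper k \<Longrightarrow> p = ?s"
      using px that super_sign_square [of x y p] by (simp add: p_def)
    then show ?thesis by (simp add: X_def)
  qed
  have Y: "q * Y = ?s * Y" if "snd x = c"
  proof -
    have "fst x = Proper k \<Longrightarrow> q = ?s"
      using py that super_sign_square [of x y q] by (simp add: q_def)
    then show ?thesis by (simp add: Y_def)
  qed
  have E1: "word_act y (word_act x F) ((c, k) # w)
      = (if snd y = c then (if snd x = fst y then G else 0) + ?s * p * P + X else 0)
        + q * ((if snd x = c then Q + Y else 0) + p * A)"
    unfolding word_act.simps(2) [of y "word_act x F"] word_act_Cons_fun
    unfolding word_act.simps(2) sx A_def P_def Q_def X_def Y_def G_def p_def q_def
    by auto
  have E2: "word_act x (word_act y F) ((c, k) # w)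
      = (if snd x = c then (if snd y = fst x then H else 0) + ?s * q * Q + Y else 0)
        + p * ((if snd y = c then P + X else 0) + q * B)"
    unfolding word_act.simps(2) [of x "word_act y F"] word_act_Cons_fun
    unfolding word_act.simps(2) sy B_def P_def Q_def X_def Y_def H_def p_def q_def
    by auto
  have E3: "(if snd x = fst y then word_act (fst x, snd y) F ((c, k) # w) else 0)
      = (if snd x = fst y \<and> snd y = c then G else 0) + p * q * C"
    using bx by (simp add: C_def G_def p_def q_def)
  have E4: "(if fst x = snd y then word_act (fst y, snd x) F ((c, k) # w) else 0)
      = (if fst x = snd y \<and> snd x = c then H else 0) + p * q * D"
    using by' by (simp add: D_def H_def p_def q_def)
  have AB: "p * q * A = ?s * (p * q * B) + p * q * C - ?s * (p * q * D)"
    using IH' unfolding A_def B_def C_def D_def p_def q_def by (simp add: algebra_simps)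
  show ?case
  \<comment> \<open>Once the sign is replaced by 1 or -1, its square disappears and only ring
    arithmetic remains.\<close>
  proof (cases "?s = 1")
    case True
    then show ?thesis
      unfolding l E1 E2 E3 E4 using AB X Y by (auto simp add: algebra_simps)
  next
    case False
    then have "?s = -1" using super_sign_cases by blast
    then show ?thesis
      unfolding l E1 E2 E3 E4 using AB X Y by (auto simp add: algebra_simps)
  qed
qed simp

section \<open>Descent of the action to the enveloping superalgebra\<close>

definition free_act :: "('a, 'b, 'l) gl_index free_alg \<Rightarrow> ((('a, 'b, 'l) symbol \<times> 'l) list \<Rightarrow> complex)
    \<Rightarrow> (('a, 'b, 'l) symbol \<times> 'l) list \<Rightarrow> complex" where
  "free_act p F y =
     (\<Sum>w\<in>Poly_Mapping.keys p. Poly_Mapping.lookup p w * fold word_act (letters w) F y)"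

lemma free_act_zero [simp]: "free_act 0 F y = 0"
  by (simp add: free_act_def)

lemma free_act_add: "free_act (p + q) F y = free_act p F y + free_act q F y"
  unfolding free_act_def
  by (rule setsum_keys_plus_distrib) (simp_all add: distrib_right)

lemma free_act_single:
  "free_act (Poly_Mapping.single w c) F y = c * fold word_act (letters w) F y"
  by (simp add: free_act_def)

lemma free_act_minus: "free_act (p - q) F y = free_act p F y - free_act q F y"
  using free_act_add [of "p - q" q F y] by simp

lemma fold_word_act_add:
  "fold word_act v (\<lambda>y. F y + G y) = (\<lambda>y. fold word_act v F y + fold word_act v G y)"
  by (induction v arbitrary: F G) (simp_all add: word_act_fun_add)

lemma fold_word_act_scale:
  "fold word_act v (\<lambda>y. t * F y) = (\<lambda>y. t * fold word_act v F y)"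
  by (induction v arbitrary: F) (simp_all add: word_act_fun_scale)

lemma free_act_fun_add: "free_act p (\<lambda>y. F y + G y) y = free_act p F y + free_act p G y"
  by (simp add: free_act_def fold_word_act_add distrib_left sum.distrib)

lemma free_act_fun_scale: "free_act p (\<lambda>y. t * F y) y = t * free_act p F y"
  by (simp add: free_act_def fold_word_act_scale sum_distrib_left mult.left_commute)

lemma free_act_fun_zero [simp]: "free_act p (\<lambda>y. 0) y = 0"
  using free_act_fun_scale [of p 0 "\<lambda>y. 0" y] by simp

lemma free_act_mult_single:
  "free_act (p * Poly_Mapping.single w c) F y = free_act (Poly_Mapping.single w c) (free_act p F) y"
proof (induction p rule: poly_mapping_add_single_induct)
  case zero
  have "free_act 0 F = (\<lambda>y. 0)" by (simp add: fun_eq_iff)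
  then show ?case by simp
next
  case (add_single p v d)
  have "free_act (p + Poly_Mapping.single v d) F
      = (\<lambda>y. free_act p F y + d * fold word_act (letters v) F y)"
    by (simp add: fun_eq_iff free_act_add free_act_single)
  then show ?case
    by (simp add: distrib_right free_act_add add_single mult_single free_act_single
        free_act_fun_add free_act_fun_scale plus_fword_def fold_word_act_add
        fold_word_act_scale distrib_left)
qed

text \<open>Functionals carry a right action: the left factor acts first.\<close>

lemma free_act_mult: "free_act (p * q) F y = free_act q (free_act p F) y"
proof (induction q rule: poly_mapping_add_single_induct)
  case (add_single q w c)
  then show ?case
    by (simp add: distrib_left free_act_add free_act_mult_single)
qed simp

lemma free_act_gen: "free_act (free_gen g) F = word_act g F"
  by (simp add: fun_eq_iff free_gen_def free_act_single)

lemma free_act_const: "free_act (free_const c) F = (\<lambda>y. c * F y)"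
  by (simp add: fun_eq_iff free_const_def free_act_single zero_fword_def)

lemma free_act_relator: "free_act (env_relator x y) F w = 0"
proof -
  let ?s = "super_sign x y"
  have "free_act (free_gen x * free_gen y) F w
      - free_act (free_const ?s * (free_gen y * free_gen x)) F w
    = word_act y (word_act x F) w - ?s * word_act x (word_act y F) w"
    by (simp only: free_act_mult free_act_gen free_act_const word_act_fun_scale)
  also have "\<dots> = free_act (gl_bracket x y) F w"
    by (simp add: word_act_bracket gl_bracket_def free_act_minus free_act_mult free_act_const
        free_act_gen word_act_scale)
  finally show ?thesis
    unfolding env_relator_def free_act_minus by simp
qed

lemma free_act_ideal: "r \<in> env_ideal \<Longrightarrow> free_act r F w = 0"
proof (induction arbitrary: F w rule: env_ideal.induct)
  case (relator p x y q)
  have "free_act (env_relator x y) (free_act p F) = (\<lambda>y. 0)"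
    by (simp add: fun_eq_iff free_act_relator)
  then show ?case
    by (simp add: free_act_mult [of "p * env_relator x y"] free_act_mult [of p, THEN ext])
qed (simp_all add: free_act_add)

lift_definition env_act :: "('a, 'b, 'l) super_env \<Rightarrow> ((('a, 'b, 'l) symbol \<times> 'l) list \<Rightarrow> complex)
    \<Rightarrow> (('a, 'b, 'l) symbol \<times> 'l) list \<Rightarrow> complex" is free_act
proof -
  fix p q :: "('a, 'b, 'l) gl_index free_alg"
  assume "env_cong p q"
  then have "free_act (p - q) F y = 0" for F y
    unfolding env_cong_def by (rule free_act_ideal)
  then show "free_act p = free_act q"
    by (simp add: fun_eq_iff free_act_minus)
qed

lemma env_act_zero [simp]: "env_act 0 F y = 0"
  by transfer simp

lemma env_act_add: "env_act (x + z) F y = env_act x F y + env_act z F y"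
  by transfer (rule free_act_add)

lemma env_act_minus: "env_act (x - z) F y = env_act x F y - env_act z F y"
  by transfer (rule free_act_minus)

lemma env_act_mult: "env_act (x * z) F y = env_act z (env_act x F) y"
  by transfer (rule free_act_mult)

lemma env_act_gen: "env_act (env_gen g) F = word_act g F"
  by transfer (rule free_act_gen)

lemma env_act_scale: "env_act (c *\<^sub>U x) F y = c * env_act x F y"
proof transfer
  fix c F y and x :: "('a, 'b, 'c) gl_index free_alg"
  show "free_act (free_const c * x) F y = c * free_act x F y"
    by (simp add: free_act_mult free_act_const free_act_fun_scale)
qed

lemma env_act_sum: "env_act (sum f A) F y = (\<Sum>i\<in>A. env_act (f i) F y)"
  by (induction A rule: infinite_finite_induct) (simp_all add: env_act_add)

lemma env_act_one: "env_act 1 F = F"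
proof transfer
  fix F :: "(('a, 'b, 'c) symbol \<times> 'c) list \<Rightarrow> complex"
  show "free_act 1 F = F"
    using free_act_const [of 1 F] by simp
qed

lemma env_act_word: "env_act (env_word w) F = fold word_act w F"
proof (induction w arbitrary: F)
  case Nil
  then show ?case by (simp add: env_act_one)
next
  case (Cons g w)
  then show ?case by (simp add: fun_eq_iff env_act_mult env_act_gen)
qed

section \<open>Faithfulness on \<open>U(gl(n))\<close>\<close>

definition proper_gen :: "'l \<times> 'l \<Rightarrow> ('a, 'b, 'l) gl_index" where
  "proper_gen x = (Proper (fst x), Proper (snd x))"

text \<open>The one letter on which the generator \<open>proper_gen x\<close> produces a constant
  term.\<close>

definition dual_letter :: "'l \<times> 'l \<Rightarrow> ('a, 'b, 'l) symbol \<times> 'l" where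
  "dual_letter x = (Proper (snd x), fst x)"

definition proper_word :: "('l \<times> 'l) list \<Rightarrow> ('a, 'b, 'l) super_env" where
  "proper_word v = env_word (map proper_gen v)"

lemma inj_dual_letter: "inj dual_letter"
  by (auto simp: inj_def dual_letter_def prod_eq_iff)

lemma letter_sign_proper_gen [simp]: "letter_sign (proper_gen x) c = 1"
  by (simp add: letter_sign_def proper_gen_def)

text \<open>A generator shortens a word by at most one letter, so the length bound on the support of
  a functional grows by at most one.\<close>

lemma word_act_vanish:
  assumes "\<And>w. m \<le> length w \<Longrightarrow> F w = 0" "m < length y"
  shows "word_act x F y = 0"
  using assms
proof (induction y arbitrary: F m)
  case (Cons l w)
  obtain c k where l: "l = (c, k)" by (cases l)
  have "word_act x (\<lambda>v. F (l # v)) w = 0"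
  proof (cases w)
    case (Cons _ _)
    with Cons.prems show ?thesis
      by (intro Cons.IH [of "m - 1"]) auto
  qed simp
  with Cons.prems show ?case by (simp add: l)
qed simp

text \<open>At the critical length the terms that keep the length vanish under \<open>F\<close>;
  what remains are the constant terms, each deleting one occurrence of the dual letter.\<close>

lemma word_act_proper_top:
  assumes "\<And>w. m < length w \<Longrightarrow> F w = 0" "length y = Suc m"
  shows "word_act (proper_gen x) F y =
    (\<Sum>i<length y. if y ! i = dual_letter x then F (take i y @ drop (Suc i) y) else 0)"
  using assms
proof (induction y arbitrary: F m)
  case (Cons l w)
  obtain c k where l: "l = (c, k)" by (cases l)
  have tail: "word_act (proper_gen x) (\<lambda>v. F (l # v)) w
      = (\<Sum>i<length w. if w ! i = dual_letter x then F (l # take i w @ drop (Suc i) w) else 0)"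
  proof (cases w)
    case (Cons _ _)
    with Cons.prems show ?thesis
      by (intro Cons.IH [of "m - 1"]) auto
  qed simp
  have head: "(if snd (proper_gen x) = c then F ((fst (proper_gen x), k) # w)
      + (if fst (proper_gen x) = Proper k then F w else 0) else 0)
    = (if l = dual_letter x then F w else 0)"
    using Cons.prems by (auto simp: l proper_gen_def dual_letter_def)
  have "word_act (proper_gen x) F (l # w) = (if l = dual_letter x then F w else 0)
      + word_act (proper_gen x) (\<lambda>v. F (l # v)) w"
    by (simp only: l word_act.simps head [unfolded l] letter_sign_proper_gen mult_1)
  with tail show ?case
    by (simp add: sum.lessThan_Suc_shift cong: if_cong del: sum.lessThan_Suc)
qed simp

text \<open>
  Applying \<open>d\<close> proper generators to the functional \<open>vacuum\<close>, evaluation at \<open>x = 1\<close>, gives a functional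
  that vanishes on monomials of degree \<open>> d\<close> in \<open>z\<close>, while on those of degree \<open>d\<close> it detects the
  multiset of the generators.
\<close>

definition detects :: "((('a, 'b, 'l) symbol \<times> 'l) list \<Rightarrow> complex)
    \<Rightarrow> (('a, 'b, 'l) symbol \<times> 'l) multiset \<Rightarrow> bool" where
  "detects F M \<longleftrightarrow> (\<forall>w. size M < length w \<longrightarrow> F w = 0)
     \<and> (\<forall>w. length w = size M \<longrightarrow> mset w \<noteq> M \<longrightarrow> F w = 0)
     \<and> (\<forall>w. mset w = M \<longrightarrow> Re (F w) > 0)"

definition vacuum :: "(('a, 'b, 'l) symbol \<times> 'l) list \<Rightarrow> complex" where
  "vacuum w = (if w = [] then 1 else 0)"

lemma detects_long: "detects F M \<Longrightarrow> size M < length w \<Longrightarrow> F w = 0"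
  and detects_other: "detects F M \<Longrightarrow> length w = size M \<Longrightarrow> mset w \<noteq> M \<Longrightarrow> F w = 0"
  and detects_same: "detects F M \<Longrightarrow> mset w = M \<Longrightarrow> Re (F w) > 0"
  unfolding detects_def by blast+

lemma detects_vacuum: "detects vacuum {#}"
  by (auto simp: detects_def vacuum_def)

lemma mset_remove_nth:
  assumes "i < length y"
  shows "add_mset (y ! i) (mset (take i y @ drop (Suc i) y)) = mset y"
proof -
  have "mset y = mset (take i y @ y ! i # drop (Suc i) y)"
    using id_take_nth_drop [OF assms] by simp
  then show ?thesis by simp
qed

text \<open>Deleting one dual letter leads back to words with content \<open>M\<close>. Proper
  generators are even, so no signs occur and the positive contributions cannot cancel.\<close>

lemma detects_word_act:
  assumes "detects F M"
  shows "detects (word_act (proper_gen x) F) (add_mset (dual_letter x) M)"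
proof -
  note M = assms [unfolded detects_def]
  have top: "word_act (proper_gen x) F w =
      (\<Sum>i<length w. if w ! i = dual_letter x then F (take i w @ drop (Suc i) w) else 0)"
    if "length w = Suc (size M)" for w
    using M that by (intro word_act_proper_top [where m = "size M"]) auto
  have 1: "word_act (proper_gen x) F w = 0" if "Suc (size M) < length w" for w
    using M that by (intro word_act_vanish [where m = "Suc (size M)"]) auto
  have 2: "word_act (proper_gen x) F w = 0"
    if "length w = Suc (size M)" "mset w \<noteq> add_mset (dual_letter x) M" for w
  proof -
    have "F (take i w @ drop (Suc i) w) = 0" if "i < length w" "w ! i = dual_letter x" for i
    proof -
      have "mset (take i w @ drop (Suc i) w) \<noteq> M"
        using mset_remove_nth [OF \<open>i < length w\<close>] that \<open>mset w \<noteq> _\<close> by auto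
      moreover have "length (take i w @ drop (Suc i) w) = size M"
        using \<open>length w = _\<close> that by simp
      ultimately show ?thesis using M by blast
    qed
    then show ?thesis
      unfolding top [OF that(1)] by (intro sum.neutral) auto
  qed
  have 3: "Re (word_act (proper_gen x) F w) > 0" if w: "mset w = add_mset (dual_letter x) M" for w
  proof -
    have len: "length w = Suc (size M)"
      using arg_cong [OF w, of size] by simp
    have pos: "Re (F (take i w @ drop (Suc i) w)) > 0"
      if "i < length w" "w ! i = dual_letter x" for i
      using mset_remove_nth [OF \<open>i < length w\<close>] that w M by auto
    have "dual_letter x \<in> set w"
      using w by (metis union_single_eq_member set_mset_mset)
    then obtain i where i: "i < length w" "w ! i = dual_letter x"
      by (auto simp: in_set_conv_nth)
    have "0 < (\<Sum>i<length w. Re (if w ! i = dual_letter x then F (take i w @ drop (Suc i) w) else 0))"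
      using i pos by (intro sum_pos2 [of _ i]) (auto intro: less_imp_le)
    then show ?thesis
      unfolding top [OF len] by simp
  qed
  show ?thesis
    unfolding detects_def using 1 2 3 by simp
qed

lemma detects_proper_word:
  "detects (env_act (proper_word v) vacuum) (mset (map dual_letter v))"
\<comment> \<open>The last generator of the word acts last, hence induction from the right.\<close>
proof (induction v rule: rev_induct)
  case (snoc x v)
  then show ?case
    using detects_word_act [of _ _ x]
    by (simp add: proper_word_def env_act_word)
qed (simp add: proper_word_def env_act_one detects_vacuum)

section \<open>The length filtration and the Poincare-Birkhoff-Witt argument\<close>

inductive_set env_filt :: "nat \<Rightarrow> ('a, 'b, 'l) super_env set" for d where
  zero: "0 \<in> env_filt d"
| word: "length v < d \<Longrightarrow> c *\<^sub>U proper_word v \<in> env_filt d"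
| add: "x \<in> env_filt d \<Longrightarrow> y \<in> env_filt d \<Longrightarrow> x + y \<in> env_filt d"

lemma env_filt_proper_word: "length v < d \<Longrightarrow> proper_word v \<in> env_filt d"
  using env_filt.word [of v d 1] by simp

lemma env_filt_mono: "x \<in> env_filt d \<Longrightarrow> d \<le> e \<Longrightarrow> x \<in> env_filt e"
  by (induction rule: env_filt.induct) (auto intro: env_filt.intros)

lemma env_filt_scale: "x \<in> env_filt d \<Longrightarrow> c *\<^sub>U x \<in> env_filt d"
  by (induction rule: env_filt.induct)
    (auto intro: env_filt.intros simp: scale_env_scale scale_env_add)

lemma env_filt_uminus: "x \<in> env_filt d \<Longrightarrow> - x \<in> env_filt d"
  using env_filt_scale [of x d "-1"] by (simp add: scale_env_minus_left)

lemma env_filt_diff: "x \<in> env_filt d \<Longrightarrow> y \<in> env_filt d \<Longrightarrow> x - y \<in> env_filt d"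
  using env_filt.add [OF _ env_filt_uminus] by fastforce

lemma proper_word_append: "proper_word (v @ w) = proper_word v * proper_word w"
  by (simp add: proper_word_def env_word_append)

text \<open>The length bounds are strict: lengths at most \<open>d\<close> and below
  \<open>e\<close> add up to a length below \<open>d + e\<close>.\<close>

lemma env_filt_mult:
  fixes x y :: "('a, 'b, 'c) super_env"
  assumes "x \<in> env_filt (Suc d)" "y \<in> env_filt e"
  shows "x * y \<in> env_filt (d + e)"
  using assms(1)
proof (induction rule: env_filt.induct)
  case (word v c)
  note v = this
  from assms(2) show ?case
  proof (induction rule: env_filt.induct)
    case (word w b)
    have "(c *\<^sub>U proper_word v) * (b *\<^sub>U proper_word w)
        = (c * b) *\<^sub>U (proper_word (v @ w) :: ('a, 'b, 'c) super_env)"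
      by (simp add: proper_word_append scale_env_mult_left [symmetric]
          scale_env_mult_right [symmetric] scale_env_scale mult.commute)
    with v word show ?case
      using env_filt.word [of "v @ w" "d + e" "c * b"] by simp
  qed (simp_all add: env_filt.zero env_filt.add distrib_left)
qed (simp_all add: env_filt.zero env_filt.add distrib_right)

lemma env_filt_mult':
  assumes "x \<in> env_filt d" "y \<in> env_filt (Suc e)"
  shows "x * y \<in> env_filt (d + e)"
proof (cases d)
  case 0
  have "x = 0" using assms(1)[unfolded 0]
    by (induction rule: env_filt.induct) auto
  then show ?thesis by (simp add: env_filt.zero)
next
  case (Suc d')
  then show ?thesis using env_filt_mult [of x d' y "Suc e"] assms by simp
qed

lemma env_filt_gen: "env_gen (Proper i, Proper j) \<in> env_filt 2"
  using env_filt_proper_word [of "[(i, j)]" 2] by (simp add: proper_word_def proper_gen_def)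

lemma env_filt_proper_gen: "env_gen (proper_gen x) \<in> env_filt (Suc 1)"
  using env_filt_gen [of "fst x" "snd x"] by (simp add: proper_gen_def numeral_2_eq_2)

lemma env_proper_filt: "x \<in> env_proper \<Longrightarrow> \<exists>d. x \<in> env_filt d"
proof (induction rule: env_proper.induct)
  case one
  then show ?case using env_filt_proper_word [of "[]" 1] by (auto simp: proper_word_def)
next
  case (add x y)
  then obtain d e where "x \<in> env_filt d" "y \<in> env_filt e" by blast
  then have "x \<in> env_filt (max d e)" "y \<in> env_filt (max d e)"
    by (simp_all add: env_filt_mono)
  then show ?case using env_filt.add by blast
next
  case (mult x y)
  then obtain d e where "x \<in> env_filt d" "y \<in> env_filt e" by blast
  then show ?case using env_filt_mult [of x d y e] env_filt_mono [of x d "Suc d"] by auto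
qed (auto intro: env_filt_gen env_filt_scale)

lemma super_sign_proper [simp]: "super_sign (Proper i, Proper j) y = 1"
  by (simp add: super_sign_def)

lemma env_gen_proper_swap:
  "env_gen (Proper i, Proper j) * env_gen (c, d) =
     env_gen (c, d) * env_gen (Proper i, Proper j)
     + (if Proper j = c then env_gen (Proper i, d) else 0)
     - (if Proper i = d then env_gen (c, Proper j) else 0)"
  using env_gen_swap [of "Proper i" "Proper j" c d] by simp

lemma env_gen_commutator_filt:
  "env_gen (proper_gen x) * env_gen (proper_gen y) - env_gen (proper_gen y) * env_gen (proper_gen x)
    \<in> env_filt 2"
  unfolding proper_gen_def env_gen_proper_swap [of "fst x"]
  by (auto intro!: env_filt_diff env_filt.add env_filt_gen env_filt.zero env_filt_uminus)

lemma proper_word_Cons: "proper_word (x # v) = env_gen (proper_gen x) * proper_word v"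
  by (simp add: proper_word_def)

lemma proper_word_past_gen:
  "(proper_word v :: ('a, 'b, 'l) super_env) * env_gen (proper_gen x) - env_gen (proper_gen x) * proper_word v
    \<in> env_filt (Suc (length v))"
proof (induction v)
  case Nil
  then show ?case by (simp add: proper_word_def env_filt.zero)
next
  case (Cons y v)
  let ?x = "env_gen (proper_gen x) :: ('a, 'b, 'l) super_env"
  let ?y = "env_gen (proper_gen y) :: ('a, 'b, 'l) super_env"
  let ?v = "proper_word v :: ('a, 'b, 'l) super_env"
  have "proper_word (y # v) * ?x - ?x * proper_word (y # v)
      = ?y * (?v * ?x - ?x * ?v) + (?y * ?x - ?x * ?y) * ?v"
    by (simp add: proper_word_Cons algebra_simps)
  moreover have "?y * (?v * ?x - ?x * ?v) \<in> env_filt (Suc (length (y # v)))"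
    using env_filt_mult [OF env_filt_proper_gen Cons.IH, of y] by simp
  moreover have "(?y * ?x - ?x * ?y) * ?v \<in> env_filt (Suc (length (y # v)))"
    using env_filt_mult' [OF env_gen_commutator_filt env_filt_proper_word, of v "length v" y x]
    by simp
  ultimately show ?case using env_filt.add by metis
qed

text \<open>The associated graded algebra is commutative: the letter \<open>x\<close> is brought to
  the front of \<open>w\<close> at the cost of shorter words, and the remaining letters are treated
  by induction.\<close>

lemma proper_word_perm:
  "mset v = mset w \<Longrightarrow>
    (proper_word v :: ('a, 'b, 'l) super_env) - proper_word w \<in> env_filt (length v)"
proof (induction v arbitrary: w)
  case Nil
  then show ?case by (simp add: env_filt.zero)
next
  case (Cons x v)
  then have "x \<in> set w" by (metis list.set_intros(1) mset_eq_setD)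
  then obtain w1 w2 where w: "w = w1 @ x # w2" by (auto simp: in_set_conv_decomp)
  with Cons.prems have v: "mset v = mset (w1 @ w2)" by simp
  then have len: "length v = length w1 + length w2" by (metis length_append size_mset)
  let ?x = "env_gen (proper_gen x) :: ('a, 'b, 'l) super_env"
  have eq: "proper_word (x # v) - proper_word w
      = ?x * (proper_word v - proper_word (w1 @ w2))
        - (proper_word w1 * ?x - ?x * proper_word w1) * proper_word w2"
    by (simp add: w proper_word_Cons proper_word_append algebra_simps)
  have "?x * (proper_word v - proper_word (w1 @ w2)) \<in> env_filt (length (x # v))"
    using env_filt_mult [OF env_filt_proper_gen Cons.IH [OF v], of x] by simp
  moreover have "(proper_word w1 * ?x - ?x * proper_word w1) * proper_word w2
      \<in> env_filt (length (x # v))"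
    using env_filt_mult' [OF proper_word_past_gen env_filt_proper_word, of w2 "length w2" w1 x]
    by (simp add: len)
  ultimately show ?case unfolding eq by (rule env_filt_diff)
qed

lemma env_filt_0: "x \<in> env_filt 0 \<Longrightarrow> x = 0"
  by (induction rule: env_filt.induct) auto

lemma finite_multisets_size: "finite {M :: 'x::finite multiset. size M = d}"
proof (rule finite_subset)
  show "{M :: 'x multiset. size M = d} \<subseteq> mset ` {v. set v \<subseteq> UNIV \<and> length v = d}"
    by (metis (mono_tags, lifting) UNIV_I ex_mset image_eqI mem_Collect_eq size_mset subsetI)
qed (simp only: finite_imageI finite_lists_length_eq finite)

text \<open>The spanning half of Poincare-Birkhoff-Witt: \<open>rep\<close> picks one ordering for
  each multiset of generators, and all other orderings differ from it by shorter words.\<close>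

lemma env_filt_top:
  fixes x :: "('a, 'b, 'l::finite) super_env"
  assumes "x \<in> env_filt (Suc d)" and rep: "\<And>M :: ('l \<times> 'l) multiset. mset (rep M) = M"
  shows "\<exists>c. x - (\<Sum>M | size M = d. c M *\<^sub>U proper_word (rep M)) \<in> env_filt d"
  using assms(1)
proof (induction rule: env_filt.induct)
  case zero
  show ?case by (intro exI [of _ "\<lambda>_. 0"]) (simp add: env_filt.zero)
next
  case (word v c)
  show ?case
  proof (cases "length v = d")
    case True
    have "(\<Sum>M | size M = d. (if M = mset v then c else 0) *\<^sub>U proper_word (rep M))
        = (\<Sum>M | size M = d. if M = mset v then c *\<^sub>U proper_word (rep (mset v)) else 0)"
      by (rule sum.cong) auto
    also have "\<dots> = c *\<^sub>U (proper_word (rep (mset v)) :: ('a, 'b, 'l) super_env)"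
      using True by (simp add: finite_multisets_size)
    finally have eq: "c *\<^sub>U (proper_word v :: ('a, 'b, 'l) super_env)
        - (\<Sum>M | size M = d. (if M = mset v then c else 0) *\<^sub>U proper_word (rep M))
        = c *\<^sub>U (proper_word v - proper_word (rep (mset v)))"
      by (simp add: scale_env_diff)
    have "(proper_word v :: ('a, 'b, 'l) super_env) - proper_word (rep (mset v)) \<in> env_filt d"
      unfolding True [symmetric] by (rule proper_word_perm) (simp add: rep)
    then show ?thesis
      by (intro exI [of _ "\<lambda>M. if M = mset v then c else 0"]) (simp only: eq env_filt_scale)
  next
    case False
    with word show ?thesis
      by (intro exI [of _ "\<lambda>_. 0"]) (simp add: env_filt.word)
  qed
next
  case (add x y)
  then obtain b c where
    "x - (\<Sum>M | size M = d. b M *\<^sub>U proper_word (rep M)) \<in> env_filt d"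
    "y - (\<Sum>M | size M = d. c M *\<^sub>U proper_word (rep M)) \<in> env_filt d" by blast
  from env_filt.add [OF this]
  show ?case
    by (intro exI [of _ "\<lambda>M. b M + c M"])
      (simp add: scale_env_add_left sum.distrib algebra_simps)
qed

lemma env_filt_act_vanish:
  "x \<in> env_filt d \<Longrightarrow> d \<le> length w \<Longrightarrow> env_act x vacuum w = 0"
proof (induction rule: env_filt.induct)
  case (word v c)
  then show ?case
    by (simp add: env_act_scale detects_long [OF detects_proper_word])
qed (simp_all add: env_act_add)

text \<open>Induction on the degree. Evaluation at the word dual to \<open>N\<close> isolates the
  coefficient \<open>c N\<close> of the top part; once all of these vanish, \<open>x\<close> has
  lower degree.\<close>

lemma env_filt_separation:
  fixes x :: "('a, 'b, 'l::finite) super_env"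
  assumes "x \<in> env_filt d" "\<And>v. env_act x vacuum (map dual_letter v) = 0"
  shows "x = 0"
  using assms
proof (induction d)
  case 0
  then show ?case by (simp add: env_filt_0)
next
  case (Suc d)
  define rep :: "('l \<times> 'l) multiset \<Rightarrow> ('l \<times> 'l) list" where "rep M = (SOME v. mset v = M)" for M
  have rep: "mset (rep M) = M" for M
    unfolding rep_def by (rule someI_ex) (rule ex_mset)
  from env_filt_top [where rep = rep, OF Suc.prems(1) rep]
  obtain c where c: "x - (\<Sum>M | size M = d. c M *\<^sub>U proper_word (rep M)) \<in> env_filt d" by blast
  have "c N = 0" if "size N = d" for N
  proof -
    let ?y = "map dual_letter (rep N) :: (('a, 'b, 'l) symbol \<times> 'l) list"
    have len: "length ?y = d" using that rep [of N] by (metis length_map size_mset)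
    have other: "env_act (proper_word (rep M)) vacuum ?y = 0" if "size M = d" "M \<noteq> N" for M
    proof -
      have "image_mset dual_letter N \<noteq> (image_mset dual_letter M :: (('a, 'b, 'l) symbol \<times> 'l) multiset)"
        using multiset.inj_map [OF inj_dual_letter] that(2) by (metis injD)
      then have "mset ?y \<noteq> mset (map dual_letter (rep M))"
        by (simp add: rep)
      moreover have "length ?y = size (mset (map dual_letter (rep M)))"
        using len that(1) rep [of M] by (metis length_map size_mset)
      ultimately show ?thesis
        using detects_other [OF detects_proper_word] by blast
    qed
    \<comment> \<open>The difference has lower degree and so vanishes on words of length
      \<open>d\<close>.\<close>
    have "0 = env_act (x - (\<Sum>M | size M = d. c M *\<^sub>U proper_word (rep M))) vacuum ?y"
      using env_filt_act_vanish [OF c] len by simp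
    also have "\<dots> = - (\<Sum>M | size M = d. c M * env_act (proper_word (rep M)) vacuum ?y)"
      by (simp only: env_act_minus Suc.prems(2) env_act_sum env_act_scale diff_0)
    also have "\<dots> = - (\<Sum>M | size M = d. if M = N then c N * env_act (proper_word (rep N)) vacuum ?y else 0)"
      using other by (intro arg_cong [of _ _ uminus] sum.cong) auto
    also have "\<dots> = - (c N * env_act (proper_word (rep N)) vacuum ?y)"
      using that by (simp add: finite_multisets_size)
    finally have "c N * env_act (proper_word (rep N)) vacuum ?y = 0" by simp
    moreover have "Re (env_act (proper_word (rep N)) vacuum ?y) > 0"
      by (rule detects_same [OF detects_proper_word]) simp
    ultimately show "c N = 0" by auto
  qed
  then have "(\<Sum>M | size M = d. c M *\<^sub>U (proper_word (rep M) :: ('a, 'b, 'l) super_env)) = 0"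
    by (intro sum.neutral) auto
  with c Suc show ?case by simp
qed

text \<open>The generator changes only letters with row index \<open>g\<close>, and \<open>y\<close>
  contains none.\<close>

lemma word_act_virtual:
  assumes "is_virtual g" "\<forall>l\<in>set y. \<not> is_virtual (fst l)"
  shows "word_act (a, g) F y = 0"
  using assms(2)
proof (induction y arbitrary: F)
  case (Cons l y)
  then show ?case using assms(1) by (cases l) auto
qed simp

section \<open>The vacuum ideal and the devirtualization map\<close>

inductive_set vac_ideal :: "('a, 'b, 'l) super_env set" where
  zero: "0 \<in> vac_ideal"
| gen: "is_virtual g \<Longrightarrow> x * env_gen (a, g) \<in> vac_ideal"
| add: "x \<in> vac_ideal \<Longrightarrow> y \<in> vac_ideal \<Longrightarrow> x + y \<in> vac_ideal"

lemma vac_ideal_mult_left: "x \<in> vac_ideal \<Longrightarrow> z * x \<in> vac_ideal"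
proof (induction rule: vac_ideal.induct)
  case (gen g x a)
  then show ?case using vac_ideal.gen [of g "z * x" a] by (simp add: mult.assoc)
qed (simp_all add: vac_ideal.zero vac_ideal.add distrib_left)

lemma vac_ideal_uminus: "x \<in> vac_ideal \<Longrightarrow> - x \<in> vac_ideal"
  using vac_ideal_mult_left [of x "-1"] by simp

lemma vac_ideal_diff: "x \<in> vac_ideal \<Longrightarrow> y \<in> vac_ideal \<Longrightarrow> x - y \<in> vac_ideal"
  using vac_ideal.add [OF _ vac_ideal_uminus] by fastforce

lemma vac_ideal_scale: "x \<in> vac_ideal \<Longrightarrow> c *\<^sub>U x \<in> vac_ideal"
  using vac_ideal_mult_left [of x "c *\<^sub>U 1"] by (simp add: scale_env_mult_left [symmetric])

lemma vac_ideal_sum: "(\<And>i. i \<in> A \<Longrightarrow> f i \<in> vac_ideal) \<Longrightarrow> sum f A \<in> vac_ideal"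
  by (induction A rule: infinite_finite_induct) (simp_all add: vac_ideal.zero vac_ideal.add)

text \<open>Exchanging the two generators leaves a correction with the same virtual second index
  \<open>g\<close>, hence again in the ideal.\<close>

lemma vac_ideal_mult_gen:
  "x \<in> vac_ideal \<Longrightarrow> x * env_gen (Proper i, Proper j) \<in> vac_ideal"
proof (induction rule: vac_ideal.induct)
  case (gen g x a)
  have "Proper i \<noteq> g" using gen by auto
  then have "x * env_gen (a, g) * env_gen (Proper i, Proper j)
      = (x * env_gen (Proper i, Proper j)) * env_gen (a, g)
        - (if Proper j = a then x * env_gen (Proper i, g) else 0)"
    by (simp add: env_gen_proper_swap [of i j a g] mult.assoc distrib_left)
  then show ?case
    using gen by (auto intro!: vac_ideal_diff intro: vac_ideal.intros)
qed (simp_all add: vac_ideal.zero vac_ideal.add distrib_right)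

lemma vac_ideal_mult_proper:
  "u \<in> env_proper \<Longrightarrow> x \<in> vac_ideal \<Longrightarrow> x * u \<in> vac_ideal"
proof (induction arbitrary: x rule: env_proper.induct)
  case (scale u c)
  then show ?case by (simp add: scale_env_mult_right [symmetric] vac_ideal_scale)
qed (simp_all add: vac_ideal_mult_gen vac_ideal.add distrib_left mult.assoc [symmetric])

lemma vac_ideal_gen: "is_virtual g \<Longrightarrow> env_gen (a, g) \<in> vac_ideal"
  using vac_ideal.gen [of g 1 a] by simp

lemma vac_ideal_act:
  assumes "x \<in> vac_ideal" "\<forall>l\<in>set y. \<not> is_virtual (fst l)"
  shows "env_act x F y = 0"
  using assms(1)
  by (induction rule: vac_ideal.induct)
    (simp_all add: env_act_add env_act_mult env_act_gen word_act_virtual [OF _ assms(2)])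

text \<open>Directness of the sum: the ideal acts by zero on words with proper row indices, and
  evaluations at such words separate U(gl(n)).\<close>

lemma env_proper_vac_ideal:
  fixes x :: "('a, 'b, 'l::finite) super_env"
  assumes "x \<in> env_proper" "x \<in> vac_ideal"
  shows "x = 0"
proof -
  obtain d where "x \<in> env_filt d"
    using env_proper_filt [OF assms(1)] by blast
  then show ?thesis
    using vac_ideal_act [OF assms(2)]
    by (rule env_filt_separation) (auto simp: dual_letter_def)
qed


section \<open>Virtual weights and normal ordering modulo the vacuum ideal\<close>

definition virt_count :: "('a, 'b, 'l) symbol \<Rightarrow> ('a, 'b, 'l) symbol \<Rightarrow> int" where
  "virt_count g h = of_bool (is_virtual h \<and> g = h)"

lemma virt_count_Proper [simp]: "virt_count (Proper i) = (\<lambda>_. 0)"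
  by (auto simp: virt_count_def fun_eq_iff)

lemma virt_count_nonneg: "0 \<le> virt_count g h"
  by (simp add: virt_count_def)

text \<open>
  \<open>graded \<mu>\<close> describes the elements that, modulo \<open>vac_ideal\<close>, are combinations of products of
  creation operators \<open>e\<^bsub>g,p\<^esub>\<close> with \<open>\<mu> g\<close> factors for each virtual \<open>g\<close>, followed by an element of
  \<open>U(gl(n))\<close>; a negative value of \<open>\<mu>\<close> leaves only \<open>vac_ideal\<close> itself.
\<close>

inductive graded :: "(('a, 'b, 'l) symbol \<Rightarrow> int) \<Rightarrow> ('a, 'b, 'l) super_env \<Rightarrow> bool" where
  ideal: "x \<in> vac_ideal \<Longrightarrow> graded \<mu> x"
| proper: "u \<in> env_proper \<Longrightarrow> graded (\<lambda>_. 0) u"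
| create: "graded \<nu> x \<Longrightarrow> is_virtual g \<Longrightarrow> \<mu> = (\<lambda>h. \<nu> h + virt_count g h)
    \<Longrightarrow> graded \<mu> (env_gen (g, Proper p) * x)"
| add: "graded \<mu> x \<Longrightarrow> graded \<mu> y \<Longrightarrow> graded \<mu> (x + y)"

lemma graded_scale: "graded \<mu> x \<Longrightarrow> graded \<mu> (c *\<^sub>U x)"
proof (induction rule: graded.induct)
  case (create \<nu> x g \<mu> p)
  then show ?case by (auto simp: scale_env_mult_right intro: graded.create)
qed (auto simp: scale_env_add intro: graded.intros vac_ideal_scale env_proper.scale)

lemma graded_uminus: "graded \<mu> x \<Longrightarrow> graded \<mu> (- x)"
  using graded_scale [of \<mu> x "-1"] by (simp add: scale_env_minus_left)

lemma graded_diff: "graded \<mu> x \<Longrightarrow> graded \<mu> y \<Longrightarrow> graded \<mu> (x - y)"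
  using graded.add [OF _ graded_uminus] by fastforce

lemma graded_zero: "graded \<mu> 0"
  by (rule graded.ideal) (rule vac_ideal.zero)

lemma graded_proper_gen:
  "graded \<mu> x \<Longrightarrow> graded \<mu> (env_gen (Proper i, Proper j) * x)"
proof (induction rule: graded.induct)
  case (create \<nu> x g \<mu> p)
  have ne: "Proper j \<noteq> g" using create.hyps(2) by auto
  have "env_gen (Proper i, Proper j) * (env_gen (g, Proper p) * x)
      = env_gen (g, Proper p) * (env_gen (Proper i, Proper j) * x)
        - (if i = p then env_gen (g, Proper j) * x else 0)"
    using ne by (simp add: mult.assoc [symmetric] env_gen_proper_swap [of i j g] left_diff_distrib)
  with create show ?case
    by (auto intro!: graded_diff graded_zero intro: graded.create)
qed (auto simp: distrib_left intro: graded.intros vac_ideal_mult_left env_proper.intros)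

text \<open>Pushed to the right, the generator either reaches U(gl(n)) and falls into the ideal, or
  contracts with a creation operator for \<open>d\<close> and turns it into one for
  \<open>g\<close>.\<close>

lemma graded_virtual_gen:
  assumes "is_virtual g" "is_virtual d"
  shows "graded \<mu> x \<Longrightarrow> graded (\<lambda>h. \<mu> h + virt_count g h - virt_count d h) (env_gen (g, d) * x)"
proof (induction rule: graded.induct)
  case (proper u)
  then show ?case
    using vac_ideal_mult_proper [OF _ vac_ideal_gen] assms by (blast intro: graded.ideal)
next
  case (create \<nu> x e \<mu> p)
  have ne: "g \<noteq> Proper p" using assms by auto
  have "env_gen (g, d) * (env_gen (e, Proper p) * x)
      = super_sign (g, d) (e, Proper p) *\<^sub>U (env_gen (e, Proper p) * (env_gen (g, d) * x))
        + (if d = e then env_gen (g, Proper p) * x else 0)"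
    using ne by
      (simp add: mult.assoc [symmetric] env_gen_swap [of g d] distrib_right scale_env_mult_left)
  moreover have "graded (\<lambda>h. \<mu> h + virt_count g h - virt_count d h)
      (env_gen (e, Proper p) * (env_gen (g, d) * x))"
    using create by (intro graded.create [OF create.IH]) auto
  moreover have "graded (\<lambda>h. \<mu> h + virt_count g h - virt_count d h) (env_gen (g, Proper p) * x)"
    if "d = e"
    using create that assms by (intro graded.create [OF create.hyps(1)]) auto
  ultimately show ?case
    by (auto intro!: graded.add graded_scale graded_zero)
qed (auto simp: distrib_left intro: graded.intros vac_ideal_mult_left)

text \<open>The two corrections from passing a creation operator are a proper generator and a
  generator between virtual symbols, both covered by the preceding lemmas.\<close>

lemma graded_annihilate_gen:
  assumes "is_virtual d"
  shows "graded \<mu> x \<Longrightarrow> graded (\<lambda>h. \<mu> h - virt_count d h) (env_gen (Proper i, d) * x)"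
proof (induction rule: graded.induct)
  case (proper u)
  then show ?case
    using vac_ideal_mult_proper [OF _ vac_ideal_gen] assms by (blast intro: graded.ideal)
next
  case (create \<nu> x e \<mu> p)
  let ?s = "super_sign (Proper i, d) (e, Proper p)"
  have "env_gen (Proper i, d) * (env_gen (e, Proper p) * x)
      = ?s *\<^sub>U (env_gen (e, Proper p) * (env_gen (Proper i, d) * x))
        + (if d = e then env_gen (Proper i, Proper p) * x else 0)
        - ?s *\<^sub>U (if i = p then env_gen (e, d) * x else 0)"
    by (simp add: mult.assoc [symmetric] env_gen_swap [of "Proper i" d] distrib_right
        left_diff_distrib scale_env_mult_left)
  moreover have "graded (\<lambda>h. \<mu> h - virt_count d h)
      (env_gen (e, Proper p) * (env_gen (Proper i, d) * x))"
    using create by (intro graded.create [OF create.IH]) auto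
  moreover have "graded (\<lambda>h. \<mu> h - virt_count d h) (env_gen (Proper i, Proper p) * x)"
    if "d = e"
    using graded_proper_gen [OF create.hyps(1), of i p] create.hyps that by simp
  moreover have "graded (\<lambda>h. \<mu> h - virt_count d h) (env_gen (e, d) * x)"
    using graded_virtual_gen [OF create.hyps(2) assms create.hyps(1)] create.hyps by simp
  ultimately show ?case
    by (auto intro!: graded.add graded_diff graded_scale graded_zero)
qed (auto simp: distrib_left intro: graded.intros vac_ideal_mult_left)

lemma graded_gen:
  assumes "graded \<mu> x"
  shows "graded (\<lambda>h. \<mu> h + virt_count a h - virt_count b h) (env_gen (a, b) * x)"
proof (cases "is_virtual b")
  case True
  show ?thesis
  proof (cases "is_virtual a")
    case False
    then obtain i where a: "a = Proper i" by (cases a) auto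
    with graded_annihilate_gen [OF True assms] show ?thesis by simp
  qed (use True assms graded_virtual_gen in blast)
next
  case False
  then obtain j where b: "b = Proper j" by (cases b) auto
  show ?thesis
  proof (cases "is_virtual a")
    case True
    with assms b show ?thesis by (auto intro: graded.create)
  next
    case False
    then obtain i where a: "a = Proper i" by (cases a) auto
    with b graded_proper_gen [OF assms] show ?thesis by simp
  qed
qed

definition virt_weight :: "('a, 'b, 'l) gl_index list \<Rightarrow> ('a, 'b, 'l) symbol \<Rightarrow> int" where
  "virt_weight w h =
     (if is_virtual h then int (count_list (map fst w) h) - int (count_list (map snd w) h) else 0)"

lemma virt_weight_Nil: "virt_weight [] = (\<lambda>_. 0)"
  by (auto simp: virt_weight_def)

lemma graded_env_word: "graded (virt_weight w) (env_word w)"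
proof (induction w)
  case Nil
  show ?case unfolding env_word_Nil virt_weight_Nil by (intro graded.proper env_proper.one)
next
  case (Cons p w)
  obtain a b where p: "p = (a, b)" by (cases p)
  have "virt_weight (p # w) = (\<lambda>h. virt_weight w h + virt_count a h - virt_count b h)"
    by (auto simp: virt_weight_def virt_count_def p)
  then show ?case using graded_gen [OF Cons, of a b] by (simp add: p)
qed

lemma graded_negative: "graded \<mu> x \<Longrightarrow> \<mu> h < 0 \<Longrightarrow> x \<in> vac_ideal"
proof (induction rule: graded.induct)
  case (create \<nu> x g \<mu> p)
  then have "\<nu> h < 0" using virt_count_nonneg [of g h] by simp
  with create show ?case by (simp add: vac_ideal_mult_left)
qed (auto intro: vac_ideal.add)

text \<open>No creation operator for \<open>d\<close> is available for contraction, so the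
  annihilator moves to the right end and into the ideal.\<close>

lemma graded_annihilate:
  assumes "is_virtual d"
  shows "graded \<mu> x \<Longrightarrow> \<mu> d = 0 \<Longrightarrow> env_gen (a, d) * x \<in> vac_ideal"
proof (induction arbitrary: a rule: graded.induct)
  case (proper u)
  then show ?case
    using vac_ideal_mult_proper [OF _ vac_ideal_gen] assms by blast
next
  case (create \<nu> x e \<mu> p)
  show ?case
  proof (cases "d = e")
    \<comment> \<open>A leading creation operator for \<open>d\<close> at total weight 0 forces a
      negative weight on the remaining factor, which then already lies in the ideal.\<close>
    case True
    with create assms have "\<nu> d < 0" by (auto simp: virt_count_def)
    with create show ?thesis
      using graded_negative by (blast intro: vac_ideal_mult_left)
  next
    case False
    let ?s = "super_sign (a, d) (e, Proper p)"
    have "env_gen (a, d) * (env_gen (e, Proper p) * x)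
        = ?s *\<^sub>U (env_gen (e, Proper p) * (env_gen (a, d) * x))
          - ?s *\<^sub>U (if a = Proper p then env_gen (e, d) * x else 0)"
      using False by (simp add: mult.assoc [symmetric] env_gen_swap [of a d] distrib_right
          left_diff_distrib scale_env_mult_left)
    moreover have "\<nu> d = 0" using create False by (simp add: virt_count_def)
    ultimately show ?thesis
      using create.IH by (auto intro!: vac_ideal_diff vac_ideal_scale intro: vac_ideal_mult_left)
  qed
qed (auto simp: distrib_left intro: vac_ideal.add vac_ideal_mult_left)

text \<open>A creation operator would have to be balanced by a negative weight, so modulo the ideal
  only a term of U(gl(n)) survives.\<close>

lemma graded_zero_weight: "graded \<mu> x \<Longrightarrow> \<mu> = (\<lambda>_. 0) \<Longrightarrow> \<exists>u\<in>env_proper. x - u \<in> vac_ideal"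
proof (induction rule: graded.induct)
  case (ideal x \<mu>)
  have "0 \<in> env_proper" using env_proper.scale [OF env_proper.one, of 0] by simp
  then show ?case using ideal by (intro bexI [of _ 0]) simp_all
next
  case (proper u)
  then show ?case by (intro bexI [of _ u]) (simp_all add: vac_ideal.zero)
next
  case (create \<nu> x g \<mu> p)
  have "\<nu> g + virt_count g g = 0" using create by metis
  then have "\<nu> g < 0" using create by (simp add: virt_count_def)
  then have "x \<in> vac_ideal" using create graded_negative by blast
  then have "env_gen (g, Proper p) * x - 0 \<in> vac_ideal" by (simp add: vac_ideal_mult_left)
  moreover have "0 \<in> env_proper" using env_proper.scale [OF env_proper.one, of 0] by simp
  ultimately show ?case by blast
next
  case (add \<mu> x y)
  then obtain u v where "u \<in> env_proper" "v \<in> env_proper" "x - u \<in> vac_ideal" "y - v \<in> vac_ideal"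
    by blast
  then show ?case
    using vac_ideal.add [of "x - u" "y - v"]
    by (intro bexI [of _ "u + v"]) (simp_all add: add_diff_add env_proper.add)
qed

section \<open>Identification of \<open>Irr\<close> and well-definedness of the projection\<close>

lemma irregular_vac_ideal:
  assumes "irregular w"
  shows "env_word w \<in> vac_ideal"
proof -
  obtain u a b v g where w: "w = u @ (a, b) # v" and g: "is_virtual g"
    and gt: "count_list (map snd ((a, b) # v)) g > count_list (map fst v) g"
    using assms unfolding irregular_def by fastforce
  have "env_word ((a, b) # v) \<in> vac_ideal"
  \<comment> \<open>Irregularity leaves two cases: \<open>v\<close> annihilates \<open>g\<close>
    more often than it creates it, or the counts balance and the letter in front of \<open>v\<close>
    annihilates \<open>g\<close>.\<close>
  proof (cases "virt_weight v g < 0")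
    case True
    then show ?thesis
      using graded_negative [OF graded_env_word] by (auto intro: vac_ideal_mult_left)
  next
    case False
    with gt g have "b = g" "virt_weight v g = 0"
      by (auto simp: virt_weight_def split: if_splits)
    then show ?thesis
      using graded_annihilate [OF g graded_env_word] by simp
  qed
  then show ?thesis
    by (simp add: w env_word_append vac_ideal_mult_left)
qed

lemma Irr_eq_vac_ideal: "Irr = vac_ideal"
proof (intro set_eqI iffI)
  fix x :: "('a, 'b, 'l) super_env"
  show "x \<in> vac_ideal" if "x \<in> Irr"
    using that
    by (induction rule: Irr.induct)
      (auto intro: vac_ideal.intros vac_ideal_mult_left irregular_vac_ideal)
  show "x \<in> Irr" if "x \<in> vac_ideal"
    using that
  proof (induction rule: vac_ideal.induct)
    case (gen g x a)
    \<comment> \<open>A single annihilator is an irregular word of length one.\<close>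
    have "irregular [(a, g)]"
      unfolding irregular_def using gen by (intro exI [of _ "[]"] exI [of _ "(a, g)"]) auto
    then show ?case using Irr.gen [of "[(a, g)]" x] by simp
  qed (auto intro: Irr.intros)
qed

lemma devirt_eqI:
  fixes u :: "('a, 'b, 'l::finite) super_env"
  assumes "u \<in> env_proper" "x - u \<in> vac_ideal"
  shows "devirt x = u"
  unfolding devirt_def Irr_eq_vac_ideal
proof (rule the_equality)
  show "u \<in> env_proper \<and> (\<exists>v\<in>vac_ideal. x = u + v)"
    using assms by (auto intro!: bexI [of _ "x - u"])
  fix u' assume u': "u' \<in> env_proper \<and> (\<exists>v\<in>vac_ideal. x = u' + v)"
  then have "x - u' \<in> vac_ideal" by auto
  then have "(x - u) - (x - u') \<in> vac_ideal"
    using assms(2) by (rule vac_ideal_diff [rotated])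
  \<comment> \<open>The difference is written as a sum with a scalar multiple, matching the closure
    rules of \<open>env_proper\<close>.\<close>
  then have "u' + (-1) *\<^sub>U u \<in> vac_ideal" by (simp add: scale_env_minus_left)
  moreover have "u' + (-1) *\<^sub>U u \<in> env_proper"
    using u' assms(1) by (intro env_proper.add env_proper.scale) auto
  ultimately have "u' + (-1) *\<^sub>U u = 0" by (rule env_proper_vac_ideal [rotated])
  then show "u' = u" by (simp add: scale_env_minus_left)
qed

lemma devirt_balanced:
  fixes w :: "('a, 'b, 'l::finite) gl_index list"
  assumes "virt_weight w = (\<lambda>_. 0)"
  shows "devirt (env_word w) \<in> env_proper \<and> env_word w - devirt (env_word w) \<in> vac_ideal"
proof -
  obtain u where "u \<in> env_proper" "env_word w - u \<in> vac_ideal"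
    using graded_zero_weight [OF graded_env_word assms] by blast
  then show ?thesis using devirt_eqI by metis
qed

text \<open>Modulo the ideal, the commutator of \<open>u\<close> with \<open>x\<close> is that of
  \<open>z\<close>, hence zero. It also lies in U(gl(n)), so directness makes it vanish
  exactly.\<close>

lemma env_proper_commute_mod_vac:
  fixes z u x :: "('a, 'b, 'l::finite) super_env"
  assumes "\<And>x. x \<in> env_proper \<Longrightarrow> z * x = x * z" "u \<in> env_proper" "z - u \<in> vac_ideal" "x \<in> env_proper"
  shows "u * x = x * u"
proof -
  have "x * (z - u) - (z - u) * x \<in> vac_ideal"
    using vac_ideal_diff [OF vac_ideal_mult_left vac_ideal_mult_proper] assms by blast
  moreover have "x * (z - u) - (z - u) * x = u * x + (-1) *\<^sub>U (x * u)"
    using assms(1) [OF assms(4)] by (simp add: algebra_simps scale_env_minus_left)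
  moreover have "u * x + (-1) *\<^sub>U (x * u) \<in> env_proper"
    using assms by (intro env_proper.add env_proper.scale env_proper.mult)
  ultimately have "u * x + (-1) *\<^sub>U (x * u) = 0"
    using env_proper_vac_ideal by metis
  then show ?thesis by (simp add: scale_env_minus_left)
qed

section \<open>Sums over row-strict tableaux\<close>

definition anticommuting :: "('x \<Rightarrow> 'r::ring_1) \<Rightarrow> bool" where
  "anticommuting g \<longleftrightarrow> (\<forall>x y. g x * g y = - (g y * g x))"

lemma anticommuting_past:
  assumes "anticommuting g"
  shows "prod_list (map g xs) * g x = (-1) ^ length xs * (g x * prod_list (map g xs))"
proof (induction xs)
  case (Cons y xs)
  have yx: "g y * g x = - (g x * g y)"
    using assms unfolding anticommuting_def by blast
  have "prod_list (map g (y # xs)) * g x = g y * (prod_list (map g xs) * g x)"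
    by (simp add: mult.assoc)
  also have "\<dots> = (-1) ^ length xs * (g y * g x * prod_list (map g xs))"
    unfolding Cons by (simp add: minus_one_power_iff mult.assoc)
  finally show ?case by (simp add: yx mult.assoc)
qed simp

text \<open>The exponent \<open>k\<close> is chosen before \<open>g\<close>: creation and
  annihilation operators of a row thus acquire the same sign, which squares to 1 in their
  product.\<close>

lemma anticommuting_perm:
  "mset xs = mset ys \<Longrightarrow> \<exists>k. \<forall>g :: 'x \<Rightarrow> 'r::ring_1. anticommuting g \<longrightarrow>
     prod_list (map g ys) = (-1) ^ k * prod_list (map g xs)"
proof (induction xs arbitrary: ys)
  case Nil
  then show ?case by (intro exI [of _ 0]) simp
next
  case (Cons x xs)
  then have "x \<in> set ys" by (metis list.set_intros(1) mset_eq_setD)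
  then obtain us vs where ys: "ys = us @ x # vs" by (auto simp: in_set_conv_decomp)
  with Cons.prems have "mset xs = mset (us @ vs)" by simp
  from Cons.IH [OF this] obtain k where
    k: "\<And>g :: 'x \<Rightarrow> 'r. anticommuting g \<Longrightarrow>
      prod_list (map g (us @ vs)) = (-1) ^ k * prod_list (map g xs)" by blast
  have "prod_list (map g ys) = (-1) ^ (length us + k) * prod_list (map g (x # xs))"
    if g: "anticommuting g" for g :: "'x \<Rightarrow> 'r"
  proof -
    have "prod_list (map g ys) = prod_list (map g us) * g x * prod_list (map g vs)"
      by (simp add: ys mult.assoc)
    also have "\<dots> = (-1) ^ length us * (g x * prod_list (map g (us @ vs)))"
      unfolding anticommuting_past [OF g] by (simp add: mult.assoc)
    also have "\<dots> = (-1) ^ (length us + k) * prod_list (map g (x # xs))"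
      unfolding k [OF g] by (simp add: minus_one_power_iff power_add)
    finally show ?thesis .
  qed
  then show ?case by blast
qed

text \<open>Two equal factors are brought together at the cost of a sign and form a square.\<close>

lemma anticommuting_not_distinct:
  assumes g: "anticommuting g" and sq: "\<And>x. g x * g x = 0" and "\<not> distinct xs"
  shows "prod_list (map g xs) = 0"
proof -
  obtain us x vs ws where xs: "xs = us @ [x] @ vs @ [x] @ ws"
    using not_distinct_decomp [OF assms(3)] by blast
  have "prod_list (map g xs)
      = prod_list (map g us) * g x * (prod_list (map g vs) * g x) * prod_list (map g ws)"
    by (simp add: xs mult.assoc)
  also have "prod_list (map g us) * g x * (prod_list (map g vs) * g x)
      = (-1) ^ length vs * (prod_list (map g us) * (g x * g x) * prod_list (map g vs))"
    unfolding anticommuting_past [OF g, of vs] by (simp add: minus_one_power_iff mult.assoc)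
  finally show ?thesis by (simp add: sq)
qed

section \<open>From row-strict tableaux to all tableaux and their reading words\<close>

lemma finite_lists_length [simp]: "finite {r :: 'l::finite list. length r = k}"
  using finite_lists_length_eq [of "UNIV :: 'l set" k] by simp

text \<open>Lists with repetitions drop out; sorting groups the others into classes of
  \<open>fact k\<close> permutations, each with one strictly increasing member.\<close>

lemma sum_lists_strict:
  fixes f :: "'l::{finite,linorder} list \<Rightarrow> 'r::ring_1"
  assumes sym: "\<And>r r'. length r = k \<Longrightarrow> mset r = mset r' \<Longrightarrow> f r = f r'"
    and alt: "\<And>r. length r = k \<Longrightarrow> \<not> distinct r \<Longrightarrow> f r = 0"
  shows "(\<Sum>r | length r = k. f r) = of_nat (fact k) * (\<Sum>r | length r = k \<and> sorted_wrt (<) r. f r)"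
proof -
  let ?D = "{r :: 'l list. length r = k \<and> distinct r}"
  let ?T = "{r :: 'l list. length r = k \<and> sorted_wrt (<) r}"
  have fin: "finite ?D" "finite ?T"
    by (rule finite_subset [OF _ finite_lists_length [of k]]; auto)+
  have "(\<Sum>r | length r = k. f r) = (\<Sum>r\<in>?D. f r)"
    using alt by (intro sum.mono_neutral_right) auto
  also have "\<dots> = (\<Sum>t\<in>?T. \<Sum>r\<in>{r\<in>?D. sort r = t}. f r)"
    by (rule sum.group [symmetric]) (auto simp: fin strict_sorted_iff)
  also have "\<dots> = (\<Sum>t\<in>?T. of_nat (fact k) * f t)"
  proof (rule sum.cong)
    fix t assume "t \<in> ?T"
    then have t: "length t = k" "distinct t" "sorted t" by (auto simp: strict_sorted_iff)
    have "{r\<in>?D. sort r = t} = permutations_of_set (set t)"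
    proof (intro set_eqI iffI)
      fix r assume "r \<in> permutations_of_set (set t)"
      then have r: "set r = set t" "distinct r" by (auto simp: permutations_of_set_def)
      then have "mset r = mset t" using t set_eq_iff_mset_eq_distinct by blast
      then show "r \<in> {r\<in>?D. sort r = t}"
        using r t by (metis (mono_tags, lifting) mem_Collect_eq mset_eq_length properties_for_sort)
    qed (auto simp: permutations_of_set_def)
    moreover have "f r = f t" if "r \<in> permutations_of_set (set t)" for r
    proof -
      from that have "mset t = mset r"
        using t set_eq_iff_mset_eq_distinct by (metis permutations_of_setD)
      with sym t show ?thesis by metis
    qed
    ultimately show "(\<Sum>r\<in>{r\<in>?D. sort r = t}. f r) = of_nat (fact k) * f t"
      using t by (simp add: distinct_card)
  qed simp
  finally show ?thesis by (simp add: sum_distrib_left)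
qed

lemma sum_lists_Cons:
  "sum f ((\<lambda>(r, S). r # S) ` (A \<times> B)) = (\<Sum>r\<in>A. \<Sum>S\<in>B. f (r # S))"
  by (subst sum.reindex) (auto simp: inj_on_def sum.cartesian_product case_prod_beta comp_def)

lemma shape_Cons:
  "{S. map length S = k # \<mu>} = (\<lambda>(r, S). r # S) ` ({r. length r = k} \<times> {S. map length S = \<mu>})"
  by (auto simp: map_eq_Cons_conv)

lemma row_strict_Cons:
  "row_strict_tableaux (k # \<mu>) =
    (\<lambda>(r, S). r # S) ` ({r. length r = k \<and> sorted_wrt (<) r} \<times> row_strict_tableaux \<mu>)"
  by (auto simp: row_strict_tableaux_def map_eq_Cons_conv)

text \<open>Induction on the rows. The hypotheses allow the altered row at any position, so they are
  inherited by \<open>f\<close> with its first row fixed.\<close>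

lemma sum_tableaux_row_strict:
  fixes f :: "'l::{finite,linorder} list list \<Rightarrow> 'r::ring_1"
  assumes "\<And>S r r' S'. map length (S @ r # S') = \<mu> \<Longrightarrow> mset r = mset r' \<Longrightarrow>
      f (S @ r # S') = f (S @ r' # S')"
    and "\<And>S r S'. map length (S @ r # S') = \<mu> \<Longrightarrow> \<not> distinct r \<Longrightarrow> f (S @ r # S') = 0"
  shows "(\<Sum>S | map length S = \<mu>. f S) =
    of_nat (prod_list (map fact \<mu>)) * (\<Sum>S\<in>row_strict_tableaux \<mu>. f S)"
  using assms
proof (induction \<mu> arbitrary: f)
  case Nil
  have "{S :: 'l list list. map length S = []} = {[]}" "row_strict_tableaux [] = {[] :: 'l list list}"
    by (auto simp: row_strict_tableaux_def)
  then show ?case by simp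
next
  case (Cons k \<mu>)
  have rest: "(\<Sum>S | map length S = \<mu>. f (r # S)) =
      of_nat (prod_list (map fact \<mu>)) * (\<Sum>S\<in>row_strict_tableaux \<mu>. f (r # S))"
    if "length r = k" for r
  proof (rule Cons.IH)
    fix S S' :: "'l list list" and t t'
    assume "map length (S @ t # S') = \<mu>"
    then have *: "map length ((r # S) @ t # S') = k # \<mu>" using that by simp
    show "f (r # S @ t # S') = f (r # S @ t' # S')" if "mset t = mset t'"
      using Cons.prems(1) [OF * that] by simp
    show "f (r # S @ t # S') = 0" if "\<not> distinct t"
      using Cons.prems(2) [OF * that] by simp
  qed
  have row: "(\<Sum>r | length r = k. f (r # S)) =
      of_nat (fact k) * (\<Sum>r | length r = k \<and> sorted_wrt (<) r. f (r # S))"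
    if "S \<in> row_strict_tableaux \<mu>" for S
  proof (rule sum_lists_strict)
    fix r :: "'l list" assume "length r = k"
    then have *: "map length ([] @ r # S) = k # \<mu>"
      using that by (simp add: row_strict_tableaux_def)
    show "f (r # S) = f (r' # S)" if "mset r = mset r'" for r'
      using Cons.prems(1) [OF * that] by simp
    show "f (r # S) = 0" if "\<not> distinct r"
      using Cons.prems(2) [OF * that] by simp
  qed
  have "(\<Sum>S | map length S = k # \<mu>. f S) = (\<Sum>r | length r = k. \<Sum>S | map length S = \<mu>. f (r # S))"
    unfolding shape_Cons sum_lists_Cons ..
  also have "\<dots> = (\<Sum>r | length r = k.
      of_nat (prod_list (map fact \<mu>)) * (\<Sum>S\<in>row_strict_tableaux \<mu>. f (r # S)))"
    using rest by (intro sum.cong) auto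
  also have "\<dots> = of_nat (prod_list (map fact \<mu>)) *
      (\<Sum>S\<in>row_strict_tableaux \<mu>. \<Sum>r | length r = k. f (r # S))"
    by (subst sum.swap) (simp add: sum_distrib_left)
  also have "\<dots> = of_nat (prod_list (map fact \<mu>)) *
      (of_nat (fact k) * (\<Sum>S\<in>row_strict_tableaux \<mu>. \<Sum>r | length r = k \<and> sorted_wrt (<) r. f (r # S)))"
    using row by (simp add: sum_distrib_left)
  also have "\<dots> = of_nat (prod_list (map fact (k # \<mu>))) * (\<Sum>S\<in>row_strict_tableaux (k # \<mu>). f S)"
    unfolding row_strict_Cons sum_lists_Cons
    by (subst sum.swap) (simp add: mult.assoc mult_of_nat_commute [of "fact k"])
  finally show ?case .
qed

lemma sum_lists_append:
  fixes F :: "'x list \<Rightarrow> 'r::comm_monoid_add"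
  shows "(\<Sum>s | length s = k + m. F s) = (\<Sum>r | length r = k. \<Sum>t | length t = m. F (r @ t))"
proof -
  have "{s :: 'x list. length s = k + m} = (\<lambda>(r, t). r @ t) ` ({r. length r = k} \<times> {t. length t = m})"
  proof (intro set_eqI iffI)
    fix s :: "'x list" assume "s \<in> {s. length s = k + m}"
    then show "s \<in> (\<lambda>(r, t). r @ t) ` ({r. length r = k} \<times> {t. length t = m})"
      by (intro image_eqI [of _ _ "(take k s, drop k s)"]) auto
  qed auto
  moreover have "inj_on (\<lambda>(r, t). r @ t) ({r :: 'x list. length r = k} \<times> {t. length t = m})"
    by (auto simp: inj_on_def)
  ultimately show ?thesis
    by (simp add: sum.reindex sum.cartesian_product) (auto intro: sum.cong)
qed

lemma sum_tableaux_concat: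
  "(\<Sum>S | map length S = \<mu>. F (concat S)) = (\<Sum>s | length s = sum_list \<mu>. F s)"
proof (induction \<mu> arbitrary: F)
  case (Cons k \<mu>)
  have "(\<Sum>S | map length S = k # \<mu>. F (concat S))
      = (\<Sum>r | length r = k. \<Sum>S | map length S = \<mu>. F (r @ concat S))"
    unfolding shape_Cons sum_lists_Cons by simp
  also have "\<dots> = (\<Sum>r | length r = k. \<Sum>s | length s = sum_list \<mu>. F (r @ s))"
    by (intro sum.cong refl Cons.IH)
  finally show ?case by (simp add: sum_lists_append)
qed simp

section \<open>Centrality\<close>

text \<open>The commutator is a derivation that replaces one proper letter \<open>j\<close> by
  \<open>i\<close>; the virtual symbols in \<open>cs\<close> give no further bracket terms.\<close>

lemma proper_gen_past_create:
  assumes "length s = length cs" "\<forall>c\<in>set cs. is_virtual c"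
  shows "env_gen (Proper i, Proper j) * env_word (zip (map Proper s) cs) =
    env_word (zip (map Proper s) cs) * env_gen (Proper i, Proper j)
    + (\<Sum>c<length s. if s ! c = j then env_word (zip (map Proper (s[c := i])) cs) else 0)"
  using assms
proof (induction s cs rule: list_induct2)
  case (Cons x s g cs)
  let ?e = "env_gen (Proper i, Proper j)" and ?W = "env_word (zip (map Proper s) cs)"
  let ?x = "env_gen (Proper x, g)"
  have "Proper i \<noteq> g" using Cons.prems by auto
  then have "?e * (?x * ?W) = ?x * (?e * ?W) + (if x = j then env_gen (Proper i, g) * ?W else 0)"
    by (auto simp: mult.assoc [symmetric] env_gen_proper_swap [of i j "Proper x"] distrib_right)
  with Cons show ?case
    by (simp add: sum.lessThan_Suc_shift mult.assoc distrib_left sum_distrib_left if_distrib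
        cong: if_cong del: sum.lessThan_Suc)
qed simp

text \<open>The dual rule, with \<open>i\<close> replaced by \<open>j\<close> and a minus sign; this
  opposite sign makes the contraction of both words invariant.\<close>

lemma proper_gen_past_annihilate:
  assumes "length cs = length s" "\<forall>c\<in>set cs. is_virtual c"
  shows "env_gen (Proper i, Proper j) * env_word (zip cs (map Proper s)) =
    env_word (zip cs (map Proper s)) * env_gen (Proper i, Proper j)
    - (\<Sum>c<length s. if s ! c = i then env_word (zip cs (map Proper (s[c := j]))) else 0)"
  using assms
proof (induction cs s rule: list_induct2)
  case (Cons g cs x s)
  let ?e = "env_gen (Proper i, Proper j)" and ?W = "env_word (zip cs (map Proper s))"
  let ?x = "env_gen (g, Proper x)"
  have "Proper j \<noteq> g" using Cons.prems by auto
  then have "?e * (?x * ?W) = ?x * (?e * ?W) - (if x = i then env_gen (g, Proper j) * ?W else 0)"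
    by (auto simp: mult.assoc [symmetric] env_gen_proper_swap [of i j g] left_diff_distrib)
  with Cons show ?case
    by (simp add: sum.lessThan_Suc_shift mult.assoc right_diff_distrib sum_distrib_left if_distrib
        diff_diff_eq add.commute cong: if_cong del: sum.lessThan_Suc)
qed simp

lemma proper_gen_commute_virtual:
  assumes "\<forall>p\<in>set w. is_virtual (fst p) \<and> is_virtual (snd p)"
  shows "env_gen (Proper i, Proper j) * env_word w = env_word w * env_gen (Proper i, Proper j)"
  using assms
proof (induction w)
  case (Cons p w)
  obtain a b where p: "p = (a, b)" by (cases p)
  let ?e = "env_gen (Proper i, Proper j)"
  have "Proper j \<noteq> a" "Proper i \<noteq> b" using Cons.prems p by auto
  then have "?e * env_word (p # w) = env_gen p * (?e * env_word w)"
    by (simp add: p mult.assoc [symmetric] env_gen_proper_swap [of i j a b])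
  also have "?e * env_word w = env_word w * ?e"
    using Cons by simp
  finally show ?case by (simp add: mult.assoc)
qed simp

text \<open>
  The two error terms produced by moving \<open>e\<^bsub>i,j\<^esub>\<close> through the sum are matched by the bijection
  \<open>s \<mapsto> s[c := i]\<close> from \<open>{s. s\<^sub>c = j}\<close> onto \<open>{s. s\<^sub>c = i}\<close>.
\<close>

lemma virtual_trace_commute:
  fixes m :: "('a, 'b, 'l::finite) super_env"
  assumes virt: "\<forall>c\<in>set cs. is_virtual c"
    and m: "env_gen (Proper i, Proper j) * m = m * env_gen (Proper i, Proper j)"
  defines "A \<equiv> \<lambda>s. env_word (zip (map Proper s) cs)"
    and "B \<equiv> \<lambda>s. env_word (zip cs (map Proper s))"
  shows "env_gen (Proper i, Proper j) * (\<Sum>s | length s = length cs. A s * m * B s)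
    = (\<Sum>s | length s = length cs. A s * m * B s) * env_gen (Proper i, Proper j)"
proof -
  let ?e = "env_gen (Proper i, Proper j) :: ('a, 'b, 'l) super_env"
  let ?L = "{s :: 'l list. length s = length cs}"
  let ?n = "length cs"
  have step: "?e * (A s * m * B s) = A s * m * B s * ?e
      + ((\<Sum>c<?n. if s ! c = j then A (s[c := i]) * m * B s else 0)
      - (\<Sum>c<?n. if s ! c = i then A s * m * B (s[c := j]) else 0))" if "s \<in> ?L" for s
  proof -
    have A: "?e * A s = A s * ?e + (\<Sum>c<?n. if s ! c = j then A (s[c := i]) else 0)"
      unfolding A_def using proper_gen_past_create [of s cs i j] that virt by simp
    have B: "?e * B s = B s * ?e - (\<Sum>c<?n. if s ! c = i then B (s[c := j]) else 0)"
      unfolding B_def using proper_gen_past_annihilate [of cs s i j] that virt by simp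
    have "?e * (A s * m * B s) = (?e * A s) * (m * B s)"
      by (simp add: mult.assoc)
    also have "\<dots> = A s * (?e * m) * B s
        + (\<Sum>c<?n. if s ! c = j then A (s[c := i]) else 0) * (m * B s)"
      unfolding A by (simp add: distrib_right mult.assoc)
    also have "A s * (?e * m) * B s = A s * m * (?e * B s)"
      unfolding m by (simp add: mult.assoc)
    also have "\<dots> = A s * m * B s * ?e - A s * m * (\<Sum>c<?n. if s ! c = i then B (s[c := j]) else 0)"
      unfolding B by (simp add: right_diff_distrib mult.assoc)
    also have "A s * m * (\<Sum>c<?n. if s ! c = i then B (s[c := j]) else 0)
        = (\<Sum>c<?n. if s ! c = i then A s * m * B (s[c := j]) else 0)"
      by (simp add: sum_distrib_left if_distrib cong: if_cong)
    also have "(\<Sum>c<?n. if s ! c = j then A (s[c := i]) else 0) * (m * B s)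
        = (\<Sum>c<?n. if s ! c = j then A (s[c := i]) * m * B s else 0)"
      by (simp add: sum_distrib_right if_distrib [of "\<lambda>z. z * (m * B s)"] mult.assoc cong: if_cong)
    finally show ?thesis by simp
  qed
  have "(\<Sum>s\<in>?L. \<Sum>c<?n. if s ! c = j then A (s[c := i]) * m * B s else 0)
      = (\<Sum>c<?n. \<Sum>s\<in>{s\<in>?L. s ! c = j}. A (s[c := i]) * m * B s)"
    by (subst sum.swap) (intro sum.cong refl sum.inter_filter [symmetric] finite_lists_length)
  also have "\<dots> = (\<Sum>c<?n. \<Sum>s\<in>{s\<in>?L. s ! c = i}. A s * m * B (s[c := j]))"
  proof (rule sum.cong)
    fix c assume "c \<in> {..<?n}"
    then show "(\<Sum>s\<in>{s\<in>?L. s ! c = j}. A (s[c := i]) * m * B s)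
        = (\<Sum>s\<in>{s\<in>?L. s ! c = i}. A s * m * B (s[c := j]))"
      by (intro sum.reindex_bij_witness [of _ "\<lambda>s. s[c := j]" "\<lambda>s. s[c := i]"])
        (auto simp: list_update_same_conv)
  qed simp
  also have "\<dots> = (\<Sum>s\<in>?L. \<Sum>c<?n. if s ! c = i then A s * m * B (s[c := j]) else 0)"
    by (rule trans [OF _ sum.swap]) (intro sum.cong refl sum.inter_filter finite_lists_length)
  finally show ?thesis
    by (simp add: sum_distrib_left sum_distrib_right step sum.distrib sum_subtractf)
qed

section \<open>Row symmetry of the bitableaux\<close>

lemma anticommuting_create: "anticommuting (\<lambda>s. env_gen (Proper s, Alpha a))"
  and anticommuting_annihilate: "anticommuting (\<lambda>s. env_gen (Alpha a, Proper s))"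
  unfolding anticommuting_def
  \<comment> \<open>These generators pair an even with an odd symbol and so are odd; both delta
    terms vanish since proper and virtual symbols differ.\<close>
  by (intro allI, subst env_gen_swap, simp add: super_sign_def scale_env_minus_left)+

lemma anticommuting_square:
  "anticommuting (g :: 'x \<Rightarrow> ('a, 'b, 'l) super_env) \<Longrightarrow> g x * g x = 0"
  unfolding anticommuting_def by (metis env_double_eq_0 eq_neg_iff_add_eq_0)

lemma env_word_row:
  "env_word (zip (map Proper r) (replicate (length r) (Alpha a))) =
     prod_list (map (\<lambda>s. env_gen (Proper s, Alpha a)) r)"
  "env_word (zip (replicate (length r) (Alpha a)) (map Proper r)) =
     prod_list (map (\<lambda>s. env_gen (Alpha a, Proper s)) r)"
  by (induction r) simp_all

lemma length_concat_cong: "map length S = map length T \<Longrightarrow> length (concat S) = length (concat T)"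
  by (simp add: length_concat)

text \<open>The product under the projection for two equal tableaux, with its virtual middle factors
  abstracted into \<open>m\<close>.\<close>

definition sandwich :: "('a, 'b, 'l) symbol list list \<Rightarrow> ('a, 'b, 'l) super_env \<Rightarrow> 'l list list
    \<Rightarrow> ('a, 'b, 'l) super_env" where
  "sandwich C m S =
     env_bitableau (map (map Proper) S) C * m * env_bitableau C (map (map Proper) S)"

lemma env_bitableau_append:
  assumes "map length S = map length T"
  shows "env_bitableau (S @ S') (T @ T') = env_bitableau S T * env_bitableau S' T'"
  using length_concat_cong [OF assms] by (simp add: env_bitableau_def env_word_append)

lemma env_bitableau_Cons:
  assumes "length r = length c"
  shows "env_bitableau (r # S') (c # T') = env_word (zip r c) * env_bitableau S' T'"
  using assms by (simp add: env_bitableau_def env_word_append)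

text \<open>A row of \<open>C\<close> repeats a single symbol, so one row of the tableau enters
  through two products over its entries, while \<open>X\<close>, \<open>Y\<close>, \<open>Z\<close>
  are independent of that row.\<close>

lemma sandwich_row:
  fixes m :: "('a, 'b, 'l) super_env"
  assumes C: "map length C = map length (S @ r # S')"
    and const: "\<forall>c\<in>set C. \<exists>a. c = replicate (length c) (Alpha a)"
  shows "\<exists>a X Y Z. \<forall>r'. length r' = length r \<longrightarrow> sandwich C m (S @ r' # S') =
    X * prod_list (map (\<lambda>s. env_gen (Proper s, Alpha a)) r') * Y
      * prod_list (map (\<lambda>s. env_gen (Alpha a, Proper s)) r') * Z"
proof -
  obtain C1 c C2 where C_eq: "C = C1 @ c # C2" and len: "map length C1 = map length S"
      "length c = length r" "map length C2 = map length S'"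
    using C by (auto simp: map_eq_append_conv map_eq_Cons_conv)
  from const C_eq obtain a where c: "c = replicate (length r) (Alpha a)"
    using len by auto
  let ?P = "map (map Proper) :: 'l list list \<Rightarrow> ('a, 'b, 'l) symbol list list"
  have "sandwich C m (S @ r' # S') =
     env_bitableau (?P S) C1 * prod_list (map (\<lambda>s. env_gen (Proper s, Alpha a)) r')
      * (env_bitableau (?P S') C2 * m * env_bitableau C1 (?P S))
      * prod_list (map (\<lambda>s. env_gen (Alpha a, Proper s)) r') * env_bitableau C2 (?P S')"
    if "length r' = length r" for r'
    using len that
    by (simp add: sandwich_def C_eq env_bitableau_append env_bitableau_Cons comp_def
        c env_word_row [of r', unfolded that] mult.assoc)
  then show ?thesis by blast
qed

lemma sandwich_sum_commute:
  fixes m :: "('a, 'b, 'l::{finite,linorder}) super_env"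
  assumes C: "map length C = \<mu>"
    and const: "\<forall>c\<in>set C. \<exists>a. c = replicate (length c) (Alpha a)"
    and m: "\<And>i j. env_gen (Proper i, Proper j) * m = m * env_gen (Proper i, Proper j)"
  shows "env_gen (Proper i, Proper j) * (\<Sum>S\<in>row_strict_tableaux \<mu>. sandwich C m S)
    = (\<Sum>S\<in>row_strict_tableaux \<mu>. sandwich C m S) * env_gen (Proper i, Proper j)"
proof -
  let ?e = "env_gen (Proper i, Proper j) :: ('a, 'b, 'l) super_env"
  let ?Z = "\<Sum>S\<in>row_strict_tableaux \<mu>. sandwich C m S"
  \<comment> \<open>The ratio between the sum over all tableaux and the sum over row-strict
    ones.\<close>
  define N :: nat where "N = prod_list (map fact \<mu>)"
  have "N \<noteq> 0" by (auto simp: N_def prod_list_zero_iff)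
  have all: "(\<Sum>S | map length S = \<mu>. sandwich C m S) = of_nat N * ?Z"
    unfolding N_def
  proof (rule sum_tableaux_row_strict)
    fix S :: "'l list list" and r S'
    assume "map length (S @ r # S') = \<mu>"
    then obtain a X Y Z where row: "\<And>r'. length r' = length r \<Longrightarrow> sandwich C m (S @ r' # S') =
        X * prod_list (map (\<lambda>s. env_gen (Proper s, Alpha a)) r') * Y
          * prod_list (map (\<lambda>s. env_gen (Alpha a, Proper s)) r') * Z"
      using sandwich_row [of C S r S' m] C const by blast
    show "sandwich C m (S @ r # S') = sandwich C m (S @ r' # S')" if perm: "mset r = mset r'" for r'
    proof -
      obtain k where k: "\<And>g :: 'l \<Rightarrow> ('a, 'b, 'l) super_env. anticommuting g \<Longrightarrow>
          prod_list (map g r') = (-1) ^ k * prod_list (map g r)"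
        using anticommuting_perm [OF perm] by blast
      show ?thesis
        unfolding row [OF refl] row [OF mset_eq_length [OF perm [symmetric]]]
          k [OF anticommuting_create] k [OF anticommuting_annihilate]
        by (simp add: minus_one_power_iff)
    qed
    show "sandwich C m (S @ r # S') = 0" if "\<not> distinct r"
      unfolding row [OF refl]
      by (simp add: anticommuting_not_distinct [OF anticommuting_create _ that]
          anticommuting_square [OF anticommuting_create])
  qed
  have virt: "\<forall>c\<in>set (concat C). is_virtual c"
    using const by (metis (no_types, lifting) UN_E in_set_replicate is_virtual.simps(1) set_concat)
  have "(\<Sum>S | map length S = \<mu>. sandwich C m S)
      = (\<Sum>s | length s = length (concat C).
          env_word (zip (map Proper s) (concat C)) * m * env_word (zip (concat C) (map Proper s)))"
    using sum_tableaux_concat [of "\<lambda>s. env_word (zip (map Proper s) (concat C)) * m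
        * env_word (zip (concat C) (map Proper s))" \<mu>] C
    by (simp add: sandwich_def env_bitableau_def map_concat length_concat)
  then have "?e * (of_nat N * ?Z) = of_nat N * ?Z * ?e"
    unfolding all [symmetric] using virtual_trace_commute [OF virt m] by simp
  \<comment> \<open>As a scalar, \<open>N\<close> moves past \<open>?e\<close> and can then be
    cancelled over the complex numbers.\<close>
  then have "of_nat N *\<^sub>U (?e * ?Z) = of_nat N *\<^sub>U (?Z * ?e)"
    unfolding scale_env_mult_right [of _ ?e ?Z] by (simp add: scale_env_of_nat mult.assoc)
  then have "(1 / of_nat N) *\<^sub>U of_nat N *\<^sub>U (?e * ?Z) = (1 / of_nat N) *\<^sub>U of_nat N *\<^sub>U (?Z * ?e)"
    by simp
  with \<open>N \<noteq> 0\<close> show ?thesis by (simp add: scale_env_scale)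
qed

section \<open>Weight balance and descent of centrality to the Schur element\<close>

lemma virt_weight_append: "virt_weight (v @ w) h = virt_weight v h + virt_weight w h"
  by (simp add: virt_weight_def)

lemma virt_weight_zip:
  assumes "length u = length v"
  shows "virt_weight (zip u v) h =
    (if is_virtual h then int (count_list u h) - int (count_list v h) else 0)"
  using assms by (simp add: virt_weight_def)

lemma commute_env_proper:
  assumes "\<And>i j. env_gen (Proper i, Proper j) * z = z * env_gen (Proper i, Proper j)"
    and "x \<in> env_proper"
  shows "z * x = x * z"
  using assms(2)
proof (induction rule: env_proper.induct)
  case (mult x y)
  then show ?case by (metis mult.assoc)
next
  case (scale x c)
  then show ?case by (simp add: scale_env_mult_left [symmetric] scale_env_mult_right [symmetric])
qed (simp_all add: assms(1) distrib_left distrib_right)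

theorem theorem4p1:
  fixes \<alpha> :: "nat \<Rightarrow> 'a::finite" and \<beta> :: "nat \<Rightarrow> 'b::finite" and lam :: "nat list"
  assumes "is_partition lam"
    and "nth_default 0 (conjugate lam) 0 \<le> CARD('l)"
    and "inj_on \<alpha> {1..length (conjugate lam)}"
    and "inj_on \<beta> {1..nth_default 0 (conjugate lam) 0}"
  shows "(schur_element \<alpha> \<beta> lam :: ('a, 'b, 'l::{finite,linorder}) super_env)
    \<in> center_of env_proper"
proof -
  define \<mu> where "\<mu> = conjugate lam"
  define c :: complex where "c = 1 / of_nat (hook_product \<mu>)"
  let ?C = "coDeruyts \<alpha> \<mu> :: ('a, 'b, 'l) symbol list list"
  let ?D = "Deruyts \<beta> \<mu> :: ('a, 'b, 'l) symbol list list"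
  define m where "m = env_bitableau ?C ?D * env_bitableau ?D ?C"
  have C: "map length ?C = \<mu>"
    by (rule nth_equalityI) (simp_all add: coDeruyts_def del: upt_Suc)
  have const: "\<forall>c\<in>set ?C. \<exists>a. c = replicate (length c) (Alpha a)"
    by (auto simp: coDeruyts_def)
  have virt_C: "\<forall>c\<in>set (concat ?C). is_virtual c" and virt_D: "\<forall>c\<in>set (concat ?D). is_virtual c"
    by (auto simp: coDeruyts_def Deruyts_def)
  have len_C: "length (concat ?C) = sum_list \<mu>" using C by (simp add: length_concat)
  have len_D: "length (concat ?D) = sum_list \<mu>"
    by (simp add: length_concat Deruyts_def comp_def del: upt_Suc)
  \<comment> \<open>The middle factors involve virtual symbols alone, so no bracket with a proper
    generator survives.\<close>
  have "env_gen (Proper i, Proper j) * m = m * env_gen (Proper i, Proper j)" for i j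
    unfolding m_def env_bitableau_def env_word_append [symmetric]
    using virt_C virt_D
    by (intro proper_gen_commute_virtual) (auto simp del: set_concat dest: set_zip_leftD set_zip_rightD)
  then have comm: "env_gen (Proper i, Proper j) * (\<Sum>S\<in>row_strict_tableaux \<mu>. sandwich ?C m S)
      = (\<Sum>S\<in>row_strict_tableaux \<mu>. sandwich ?C m S) * env_gen (Proper i, Proper j)" for i j
    by (intro sandwich_sum_commute C const)
  define Y :: "'l list list \<Rightarrow> ('a, 'b, 'l) super_env" where "Y S = double_young_capelli \<alpha> \<beta> \<mu> S S" for S
  have Y: "Y S \<in> env_proper \<and> sandwich ?C m S - Y S \<in> vac_ideal"
    if "S \<in> row_strict_tableaux \<mu>" for S :: "'l list list"
  proof -
    let ?s = "map Proper (concat S) :: ('a, 'b, 'l) symbol list"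
    let ?w = "zip ?s (concat ?C) @ zip (concat ?C) (concat ?D) @ zip (concat ?D) (concat ?C)
      @ zip (concat ?C) ?s"
    have eq: "sandwich ?C m S = env_word ?w"
      by (simp add: sandwich_def m_def env_bitableau_def env_word_append map_concat mult.assoc)
    have len_s: "length ?s = sum_list \<mu>"
      using that by (simp add: length_concat row_strict_tableaux_def)
    \<comment> \<open>The second index list of each block is the first of the next, and the outer
      ends agree, so the weights telescope to zero.\<close>
    have "virt_weight ?w = (\<lambda>_. 0)"
      by (auto simp: fun_eq_iff virt_weight_append virt_weight_zip len_s len_C len_D
          simp del: length_map)
    moreover have "Y S = devirt (env_word ?w)"
      by (simp add: Y_def double_young_capelli_def Let_def env_bitableau_def env_word_append
          map_concat mult.assoc)
    ultimately show ?thesis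
      using devirt_balanced [of ?w] eq by simp
  qed
  \<comment> \<open>The virtual sum \<open>?z\<close> commutes exactly with U(gl(n));
    \<open>?u\<close> is its image under the projection and differs from it by an element of the
    ideal.\<close>
  let ?u = "c *\<^sub>U (\<Sum>S\<in>row_strict_tableaux \<mu>. Y S)"
  let ?z = "c *\<^sub>U (\<Sum>S\<in>row_strict_tableaux \<mu>. sandwich ?C m S)"
  have sum_proper: "sum Y A \<in> env_proper" if "A \<subseteq> row_strict_tableaux \<mu>" for A
    using that
  proof (induction A rule: infinite_finite_induct)
    case empty
    show ?case using env_proper.scale [OF env_proper.one, of 0] by simp
  next
    case (infinite A)
    then show ?case using env_proper.scale [OF env_proper.one, of 0] by simp
  qed (use Y in \<open>auto intro: env_proper.add\<close>)
  then have u: "?u \<in> env_proper" by (intro env_proper.scale) simp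
  have "?z - ?u = c *\<^sub>U (\<Sum>S\<in>row_strict_tableaux \<mu>. sandwich ?C m S - Y S)"
    by (simp add: scale_env_diff sum_subtractf)
  also have "\<dots> \<in> vac_ideal"
    using Y by (intro vac_ideal_scale vac_ideal_sum) auto
  finally have zu: "?z - ?u \<in> vac_ideal" .
  have "env_gen (Proper i, Proper j) * ?z = ?z * env_gen (Proper i, Proper j)" for i j
    using comm by (simp add: scale_env_mult_left [symmetric] scale_env_mult_right [symmetric])
  then have "?z * x = x * ?z" if "x \<in> env_proper" for x
    using that by (rule commute_env_proper)
  then have "?u * x = x * ?u" if "x \<in> env_proper" for x
    using env_proper_commute_mod_vac [OF _ u zu that] by blast
  moreover have "schur_element \<alpha> \<beta> lam = ?u"
    by (simp add: schur_element_def c_def \<mu>_def Y_def)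
  ultimately show ?thesis
    using u by (simp add: center_of_def)
qed

end
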